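(* There exist real-analytic sub-Riemannian manifolds admitting branching strictly abnormal minimizing geodesics. Concretely, in the polynomial sub-Riemannian manifold $\mathcal M$ (for any odd $b\ge5$) there are $s,\varepsilon>0$ such that the strictly abnormal minimizing geodesics $\gamma|_{[-s,\varepsilon]}$ and $\bar\gamma|_{[-s,\varepsilon]}$ (reparametrized by arc length) coincide on $[-s,0]$ and differ on $[-s,\tau]$ for every $\tau\in(0,\varepsilon]$.
   Context: Fix an odd integer $b\geq5$ and set $q=b/2$. Let $P(x)=x_1^2-x_2^b$. On $\mathbb{R}^3$ let $X_1=\partial_{x_1}$, $X_2=\partial_{x_2}+P(x)^2\partial_{x_3}$, and let $\mathcal M=(\mathbb{R}^3,\mathrm{span}\{X_1,X_2\},g)$ with $g$ making $\{X_1,X_2\}$ orthonormal. Horizontal curves, their length $L_{\rm SR}$ and the distance $d_{\rm SR}$ are defined as usual; a minimizing geodesic is an arc-length parametrized horizontal curve realizing the distance between its endpoints. $\gamma(t)=\bar\gamma(t)=(0,t,\tfrac{t^{2b+1}}{2b+1})$ for $t<0$, $\gamma(t)=(t^q,t,0)$ and $\bar\gamma(t)=(-t^q,t,0)$ for $t\ge0$. A minimizing geodesic $\eta:[0,T]\to M$ is branching at $t\in(0,T)$ if there is a minimizing geodesic $\eta':[0,T]\to M$ with $\eta|_{[0,t]}=\eta'|_{[0,t]}$ and $\eta|_{[0,\tau]}\ne\eta'|_{[0,\tau]}$ for all $\tau\in(t,T]$. A curve is strictly abnormal if it is an abnormal extremal (in the sense of the Pontryagin Maximum Principle) but not a normal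 one. *)

theory Defs
  imports "HOL-Analysis.Analysis"
begin

definition P :: "nat \<Rightarrow> real^3 \<Rightarrow> real" where
  "P b x = (x$1)^2 - (x$2)^b"

definition X1 :: "real^3 \<Rightarrow> real^3" where
  "X1 x = vector [1, 0, 0]"

definition X2 :: "nat \<Rightarrow> real^3 \<Rightarrow> real^3" where
  "X2 b x = vector [0, 1, (P b x)^2]"

definition horizontal_ctrl ::
  "nat \<Rightarrow> (real \<Rightarrow> real^3) \<Rightarrow> (real \<Rightarrow> real) \<Rightarrow> (real \<Rightarrow> real) \<Rightarrow> real \<Rightarrow> real \<Rightarrow> bool" where
  "horizontal_ctrl b \<eta> u1 u2 a c \<longleftrightarrow> a \<le> c
     \<and> set_integrable lborel {a..c} u1 \<and> set_integrable lborel {a..c} u2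
     \<and> set_integrable lborel {a..c} (\<lambda>s. u1 s *\<^sub>R X1 (\<eta> s) + u2 s *\<^sub>R X2 b (\<eta> s))
     \<and> (\<forall>t\<in>{a..c}. \<eta> t = \<eta> a + (LINT s:{a..t}|lborel. u1 s *\<^sub>R X1 (\<eta> s) + u2 s *\<^sub>R X2 b (\<eta> s)))"

definition ctrl_length :: "(real \<Rightarrow> real) \<Rightarrow> (real \<Rightarrow> real) \<Rightarrow> real \<Rightarrow> real \<Rightarrow> real" where
  "ctrl_length u1 u2 a c = (LINT s:{a..c}|lborel. sqrt ((u1 s)^2 + (u2 s)^2))"

text \<open>Sub-Riemannian length of a horizontal curve (the control is unique a.e.,
  since X1, X2 are everywhere linearly independent).\<close>
definition L_SR :: "nat \<Rightarrow> (real \<Rightarrow> real^3) \<Rightarrow> real \<Rightarrow> real \<Rightarrow> real" where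
  "L_SR b \<eta> a c = Inf {ctrl_length u1 u2 a c | u1 u2. horizontal_ctrl b \<eta> u1 u2 a c}"

definition d_SR :: "nat \<Rightarrow> real^3 \<Rightarrow> real^3 \<Rightarrow> real" where
  "d_SR b p q = Inf {ctrl_length u1 u2 a c | \<eta> u1 u2 a c.
      horizontal_ctrl b \<eta> u1 u2 a c \<and> \<eta> a = p \<and> \<eta> c = q}"

definition arclength_ctrl :: "(real \<Rightarrow> real) \<Rightarrow> (real \<Rightarrow> real) \<Rightarrow> real \<Rightarrow> real \<Rightarrow> bool" where
  "arclength_ctrl u1 u2 a c \<longleftrightarrow> (AE t in lborel. t \<in> {a..c} \<longrightarrow> (u1 t)^2 + (u2 t)^2 = 1)"

definition minimizing_geodesic :: "nat \<Rightarrow> (real \<Rightarrow> real^3) \<Rightarrow> real \<Rightarrow> real \<Rightarrow> bool" where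
  "minimizing_geodesic b \<eta> a c \<longleftrightarrow>
     (\<exists>u1 u2. horizontal_ctrl b \<eta> u1 u2 a c \<and> arclength_ctrl u1 u2 a c)
     \<and> L_SR b \<eta> a c = d_SR b (\<eta> a) (\<eta> c)"

definition grad_h :: "(real^3 \<Rightarrow> real^3) \<Rightarrow> real^3 \<Rightarrow> real^3 \<Rightarrow> real^3" where
  "grad_h X l x = (\<chi> j. frechet_derivative (\<lambda>y. l \<bullet> X y) (at x) (axis j 1))"

text \<open>Adjoint equation of the PMP along (eta,u), in integral form
  (lambda absolutely continuous, lambda' = - d_x (u1 h_X1 + u2 h_X2)).\<close>
definition adjoint_eq ::
  "nat \<Rightarrow> (real \<Rightarrow> real^3) \<Rightarrow> (real \<Rightarrow> real) \<Rightarrow> (real \<Rightarrow> real) \<Rightarrow> (real \<Rightarrow> real^3) \<Rightarrow> real \<Rightarrow> real \<Rightarrow> bool" where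
  "adjoint_eq b \<eta> u1 u2 p a c \<longleftrightarrow>
     set_integrable lborel {a..c}
        (\<lambda>s. u1 s *\<^sub>R grad_h X1 (p s) (\<eta> s) + u2 s *\<^sub>R grad_h (X2 b) (p s) (\<eta> s))
     \<and> (\<forall>t\<in>{a..c}. p t = p a - (LINT s:{a..t}|lborel.
            u1 s *\<^sub>R grad_h X1 (p s) (\<eta> s) + u2 s *\<^sub>R grad_h (X2 b) (p s) (\<eta> s)))"

text \<open>Abnormal extremal: a nonvanishing covector curve solving the adjoint equation
  and annihilating the distribution along the curve (PMP with lambda_0 = 0).\<close>
definition abnormal_extremal :: "nat \<Rightarrow> (real \<Rightarrow> real^3) \<Rightarrow> real \<Rightarrow> real \<Rightarrow> bool" where
  "abnormal_extremal b \<eta> a c \<longleftrightarrow> (\<exists>u1 u2 p. horizontal_ctrl b \<eta> u1 u2 a c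
     \<and> adjoint_eq b \<eta> u1 u2 p a c
     \<and> (\<forall>t\<in>{a..c}. p t \<noteq> 0 \<and> p t \<bullet> X1 (\<eta> t) = 0 \<and> p t \<bullet> X2 b (\<eta> t) = 0))"

text \<open>Normal extremal: projection of a trajectory of the normal Hamiltonian
  H = (h_X1^2 + h_X2^2)/2, i.e. u_i = <lambda, X_i(eta)> a.e. plus the adjoint equation.\<close>
definition normal_extremal :: "nat \<Rightarrow> (real \<Rightarrow> real^3) \<Rightarrow> real \<Rightarrow> real \<Rightarrow> bool" where
  "normal_extremal b \<eta> a c \<longleftrightarrow> (\<exists>u1 u2 p. horizontal_ctrl b \<eta> u1 u2 a c
     \<and> adjoint_eq b \<eta> u1 u2 p a c
     \<and> (AE t in lborel. t \<in> {a..c} \<longrightarrow>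
           u1 t = p t \<bullet> X1 (\<eta> t) \<and> u2 t = p t \<bullet> X2 b (\<eta> t)))"

definition strictly_abnormal :: "nat \<Rightarrow> (real \<Rightarrow> real^3) \<Rightarrow> real \<Rightarrow> real \<Rightarrow> bool" where
  "strictly_abnormal b \<eta> a c \<longleftrightarrow> abnormal_extremal b \<eta> a c \<and> \<not> normal_extremal b \<eta> a c"

definition gamma :: "nat \<Rightarrow> real \<Rightarrow> real^3" where
  "gamma b t = (if t < 0 then vector [0, t, t^(2*b+1) / real (2*b+1)]
                else vector [t powr (real b / 2), t, 0])"

definition gamma_bar :: "nat \<Rightarrow> real \<Rightarrow> real^3" where
  "gamma_bar b t = (if t < 0 then vector [0, t, t^(2*b+1) / real (2*b+1)]
                    else vector [- (t powr (real b / 2)), t, 0])"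

end

theory Submission
  imports Defs
begin

text \<open>
  Put \<open>q = b/2\<close>. A horizontal curve is determined by its planar projection \<open>(x, y)\<close>, whose Euclidean
  length is the sub-Riemannian length, and a competitor of \<open>\<gamma>\<close> satisfies \<open>\<integral> defect(x, y) dy = 0\<close>, where
  \<open>defect \<ge> 0\<close> vanishes exactly on the two curves. Graphs over the \<open>y\<close>-axis are therefore rigid, and a
  shorter competitor must move backward in \<open>y\<close>. The unit tangent field of \<open>x = y\<^sub>+\<^sup>q\<close>, extended
  independently of \<open>x\<close>, calibrates up to an error term \<open>gain\<close>, and a shorter competitor has
  backward variation and excess length at most \<open>gain\<close>. On the one hand, backtracking pays little:
  since \<open>sqrt defect\<close> is Lipschitz, the defect is \<open>O(gain\<^sup>2)\<close> along the competitor, so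
  \<open>\<integral> defect |dy| = O(gain\<^sup>3)\<close>. On the other hand, the gain obtained from a total defect \<open>D\<close> is
  \<open>O(D powr ((b - 1) / (2 b + 1)))\<close>, the worst case being a shortcut near the cusp. For \<open>b \<ge> 5\<close> the
  exponent \<open>3 (b - 1) / (2 b + 1)\<close> exceeds 1, so a small positive \<open>gain\<close> is impossible.
\<close>

section \<open>Indefinite integrals of integrable controls\<close>

text \<open>The arcs are strictly abnormal, so no normal covector supplies a calibration; a planar
  calibration must be imperfect, since x = y^q is not a straight line and can be cut short. The
  height constraint has to limit that saving. Origin of the exponents: cutting the corner at height
  d saves a length of order d^(2q-1) = d^(b-1), because the slope is of order d^(q-1). The defect is
  then of order d^(2b) over a stretch of length d, so the cost is D of order d^(2b+1). Young's
  inequality at a free scale d makes this rigorous: up to small multiples of \<open>gain\<close>,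
  \<open>gain\<close> is at most a constant times D / d^(b+2) + d^(b-1). The second zero curve x =
  -y^q of the defect is harmless: for forward motion the density of \<open>gain\<close> is
  nonpositive wherever x <= y^q. The other arc is covered by reflection in x. Smallness comes in two
  stages. A crude bound makes \<open>gain\<close> small against the half-length e, so the curve has
  enough vertical variation for the defect estimate; only then does the sharp estimate rule
  \<open>gain\<close> out.\<close>

definition ac :: "real \<Rightarrow> real \<Rightarrow> (real \<Rightarrow> real) \<Rightarrow> (real \<Rightarrow> real) \<Rightarrow> bool" where
  "ac a c x u \<longleftrightarrow> u absolutely_integrable_on {a..c} \<and> (\<forall>t\<in>{a..c}. x t = x a + integral {a..t} u)"

lemma ac_integrable:
  assumes "ac a c x u" "a \<le> r" "t \<le> c"
  shows "u absolutely_integrable_on {r..t}" "u integrable_on {r..t}" "(\<lambda>t. \<bar>u t\<bar>) integrable_on {r..t}"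
proof -
  show A: "u absolutely_integrable_on {r..t}"
    using assms unfolding ac_def by (metis absolutely_integrable_on_subinterval atLeastatMost_subset_iff)
  then show "u integrable_on {r..t}" "(\<lambda>t. \<bar>u t\<bar>) integrable_on {r..t}"
    unfolding absolutely_integrable_on_def by auto
qed

lemma ac_eq:
  assumes "ac a c x u" "a \<le> t" "t \<le> c" shows "x t = x a + integral {a..t} u"
  using assms unfolding ac_def by (meson atLeastAtMost_iff)

lemma ac_diff:
  assumes "ac a c x u" "a \<le> r" "r \<le> t" "t \<le> c"
  shows "x t - x r = integral {r..t} u"
proof -
  have "integral {a..r} u + integral {r..t} u = integral {a..t} u"
    using assms by (intro Henstock_Kurzweil_Integration.integral_combine ac_integrable(2)[OF assms(1)]) auto
  moreover have "x r = x a + integral {a..r} u" "x t = x a + integral {a..t} u"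
    using assms by (auto intro!: ac_eq)
  ultimately show ?thesis by linarith
qed

lemma ac_continuous:
  assumes "ac a c x u" shows "continuous_on {a..c} x"
proof -
  have "u integrable_on {a..c}" using assms unfolding ac_def absolutely_integrable_on_def by auto
  then have "continuous_on {a..c} (\<lambda>t. x a + integral {a..t} u)"
    by (intro continuous_intros indefinite_integral_continuous_1)
  then show ?thesis by (rule continuous_on_eq) (use assms in \<open>auto intro: ac_eq[symmetric]\<close>)
qed

lemma absolutely_integrable_continuous_mult:
  fixes f u :: "real \<Rightarrow> real"
  assumes "continuous_on {a..c} f" "u absolutely_integrable_on {a..c}"
  shows "(\<lambda>t. f t * u t) absolutely_integrable_on {a..c}"
  by (intro absolutely_integrable_bounded_measurable_product_real assms
       continuous_imp_measurable_on_sets_lebesgue compact_imp_bounded compact_continuous_image) auto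

lemma ac_add:
  assumes "ac a c x u" "ac a c y v" shows "ac a c (\<lambda>t. x t + y t) (\<lambda>t. u t + v t)"
  unfolding ac_def
proof (intro conjI ballI)
  show "(\<lambda>t. u t + v t) absolutely_integrable_on {a..c}"
    using assms unfolding ac_def by (intro set_integral_add) auto
  fix t assume t: "t \<in> {a..c}"
  then show "x t + y t = x a + y a + integral {a..t} (\<lambda>t. u t + v t)"
    using ac_integrable(2)[OF assms(1), of a t] ac_integrable(2)[OF assms(2), of a t]
      ac_eq[OF assms(1), of t] ac_eq[OF assms(2), of t] by (simp add: integral_add)
qed

lemma ac_cmult:
  assumes "ac a c x u" shows "ac a c (\<lambda>t. k * x t) (\<lambda>t. k * u t)"
  unfolding ac_def
proof (intro conjI ballI)
  show "(\<lambda>t. k * u t) absolutely_integrable_on {a..c}"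
    using assms unfolding ac_def by (intro set_integrable_mult_right) auto
  show "k * x t = k * x a + integral {a..t} (\<lambda>t. k * u t)" if "t \<in> {a..c}" for t
    using ac_eq[OF assms, of t] that by (simp add: ring_distribs)
qed

text \<open>By the mean value and intermediate value theorems, an increment of \<open>\<phi> \<circ> y\<close> over a short
  interval is \<open>\<phi>' (y \<xi>)\<close> times the increment of \<open>y\<close> for some \<open>\<xi>\<close> in that interval, so the error in the
  chain rule is a small multiple of the variation of \<open>y\<close>; Bolzano's principle makes this global.\<close>
lemma ac_compose:
  assumes ac: "ac a c y v"
    and d: "\<And>z. (\<phi> has_real_derivative \<phi>' z) (at z)" and c: "continuous_on UNIV \<phi>'"
  shows "ac a c (\<lambda>t. \<phi> (y t)) (\<lambda>t. \<phi>' (y t) * v t)"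
proof -
  define w where "w = (\<lambda>t. \<phi>' (y t) * v t)"
  have cy: "continuous_on {a..c} y" by (rule ac_continuous[OF ac])
  have cpy: "continuous_on {a..c} (\<lambda>t. \<phi>' (y t))"
    by (rule continuous_on_compose2[OF c cy]) auto
  have w: "w absolutely_integrable_on {a..c}"
    unfolding w_def using ac cpy by (intro absolutely_integrable_continuous_mult) (auto simp: ac_def)
  have wi: "w integrable_on {r..t}" if "a \<le> r" "t \<le> c" for r t
    using w that unfolding absolutely_integrable_on_def
    by (metis integrable_on_subinterval atLeastatMost_subset_iff)
  have main: "\<bar>\<phi> (y t) - \<phi> (y a) - integral {a..t} w\<bar> \<le> e * integral {a..t} (\<lambda>t. \<bar>v t\<bar>)"
    if e: "e > 0" and t: "t \<in> {a..c}" for e t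
  proof -
    define Q where "Q = (\<lambda>r t. a \<le> r \<longrightarrow> t \<le> c \<longrightarrow>
      \<bar>\<phi> (y t) - \<phi> (y r) - integral {r..t} w\<bar> \<le> e * integral {r..t} (\<lambda>t. \<bar>v t\<bar>))"
    have "Q a t"
    proof (rule Bolzano)
      show "a \<le> t" using t by simp
    next
      fix r s t assume Q: "Q r s" "Q s t" and o: "r \<le> s" "s \<le> t"
      show "Q r t" unfolding Q_def
      proof (intro impI)
        assume ar: "a \<le> r" and tc: "t \<le> c"
        have 1: "integral {r..s} w + integral {s..t} w = integral {r..t} w"
          using o ar tc by (intro Henstock_Kurzweil_Integration.integral_combine wi) auto
        have 2: "integral {r..s} (\<lambda>t. \<bar>v t\<bar>) + integral {s..t} (\<lambda>t. \<bar>v t\<bar>) = integral {r..t} (\<lambda>t. \<bar>v t\<bar>)"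
          using o ar tc by (intro Henstock_Kurzweil_Integration.integral_combine ac_integrable[OF ac]) auto
        show "\<bar>\<phi> (y t) - \<phi> (y r) - integral {r..t} w\<bar> \<le> e * integral {r..t} (\<lambda>t. \<bar>v t\<bar>)"
          using Q o ar tc unfolding Q_def 1[symmetric] 2[symmetric] ring_distribs by auto
      qed
    next
      fix z assume z: "a \<le> z" "z \<le> t"
      then have "z \<in> {a..c}" using t by auto
      then obtain dd where dd: "dd > 0"
        "\<And>z'. z' \<in> {a..c} \<Longrightarrow> dist z' z < dd \<Longrightarrow> dist (\<phi>' (y z')) (\<phi>' (y z)) < e / 2"
        using cpy e unfolding continuous_on_iff by (metis half_gt_zero)
      show "\<exists>d>0. \<forall>r t. r \<le> z \<and> z \<le> t \<and> t - r < d \<longrightarrow> Q r t"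
      proof (intro exI[of _ dd] conjI allI impI dd(1))
        fix r t assume rt: "r \<le> z \<and> z \<le> t \<and> t - r < dd"
        show "Q r t" unfolding Q_def
        proof (intro impI)
          assume ar: "a \<le> r" and tc: "t \<le> c"
          have "\<exists>\<zeta>\<in>closed_segment (y r) (y t). \<phi> (y t) - \<phi> (y r) = \<phi>' \<zeta> * (y t - y r)"
          proof (cases "y r = y t")
            case False
            then consider "y r < y t" | "y t < y r" by linarith
            then show ?thesis
            proof cases
              case 1
              from MVT2[OF 1, of \<phi> \<phi>'] d obtain \<zeta> where "y r < \<zeta>" "\<zeta> < y t"
                "\<phi> (y t) - \<phi> (y r) = (y t - y r) * \<phi>' \<zeta>" by blast
              then show ?thesis by (intro bexI[of _ \<zeta>]) (auto simp: closed_segment_eq_real_ivl)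
            next
              case 2
              from MVT2[OF 2, of \<phi> \<phi>'] d obtain \<zeta> where "y t < \<zeta>" "\<zeta> < y r"
                "\<phi> (y r) - \<phi> (y t) = (y r - y t) * \<phi>' \<zeta>" by blast
              then show ?thesis by (intro bexI[of _ \<zeta>]) (auto simp: closed_segment_eq_real_ivl algebra_simps)
            qed
          qed auto
          then obtain \<zeta> where \<zeta>: "\<zeta> \<in> closed_segment (y r) (y t)"
            "\<phi> (y t) - \<phi> (y r) = \<phi>' \<zeta> * (y t - y r)" by blast
          have crt: "connected (y ` {r..t})"
            using cy ar tc by (intro connected_continuous_image) (auto intro: continuous_on_subset)
          have "\<zeta> \<in> y ` {r..t}"
            using \<zeta>(1) connected_contains_Icc[OF crt, of "y r" "y t"]
              connected_contains_Icc[OF crt, of "y t" "y r"] rt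
            unfolding closed_segment_eq_real_ivl by (auto split: if_splits)
          then obtain \<xi> where \<xi>: "\<xi> \<in> {r..t}" "\<zeta> = y \<xi>" by auto
          have yd: "y t - y r = integral {r..t} v" using ac_diff[OF ac] ar tc rt by auto
          have eq: "\<phi> (y t) - \<phi> (y r) - integral {r..t} w = integral {r..t} (\<lambda>s. (\<phi>' (y \<xi>) - \<phi>' (y s)) * v s)"
            using ac_integrable(2)[OF ac ar tc] wi[OF ar tc]
            unfolding \<zeta> yd \<xi> ring_distribs w_def
            by (subst integral_diff) (auto intro: integrable_on_mult_right)
          have "norm (integral {r..t} (\<lambda>s. (\<phi>' (y \<xi>) - \<phi>' (y s)) * v s)) \<le> integral {r..t} (\<lambda>s. e * \<bar>v s\<bar>)"
          proof (rule integral_norm_bound_integral)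
            show "(\<lambda>s. (\<phi>' (y \<xi>) - \<phi>' (y s)) * v s) integrable_on {r..t}"
              using ac_integrable(2)[OF ac ar tc] wi[OF ar tc] unfolding ring_distribs w_def
              by (intro integrable_diff integrable_on_mult_right)
            show "(\<lambda>s. e * \<bar>v s\<bar>) integrable_on {r..t}"
              by (intro integrable_on_mult_right ac_integrable[OF ac ar tc])
            fix s assume s: "s \<in> {r..t}"
            have "dist (\<phi>' (y s)) (\<phi>' (y z)) < e/2" "dist (\<phi>' (y \<xi>)) (\<phi>' (y z)) < e/2"
              by (rule dd(2); use s \<xi> rt ar tc in \<open>auto simp: dist_real_def\<close>)+
            then have "\<bar>\<phi>' (y \<xi>) - \<phi>' (y s)\<bar> \<le> e" unfolding dist_real_def by linarith
            then show "norm ((\<phi>' (y \<xi>) - \<phi>' (y s)) * v s) \<le> e * \<bar>v s\<bar>"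
              by (auto simp: abs_mult intro: mult_right_mono)
          qed
          then show "\<bar>\<phi> (y t) - \<phi> (y r) - integral {r..t} w\<bar> \<le> e * integral {r..t} (\<lambda>t. \<bar>v t\<bar>)"
            unfolding eq by simp
        qed
      qed
    qed
    then show ?thesis using t unfolding Q_def by auto
  qed
  have "\<phi> (y t) = \<phi> (y a) + integral {a..t} w" if t: "t \<in> {a..c}" for t
  proof -
    define I where "I = integral {a..t} (\<lambda>t. \<bar>v t\<bar>)"
    have I: "I \<ge> 0" unfolding I_def using ac_integrable(3)[OF ac] t by (intro integral_nonneg) auto
    have "\<bar>\<phi> (y t) - \<phi> (y a) - integral {a..t} w\<bar> \<le> 0 + e" if "e > 0" for e
    proof -
      have "\<bar>\<phi> (y t) - \<phi> (y a) - integral {a..t} w\<bar> \<le> e / (I + 1) * I"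
        unfolding I_def using t that I by (intro main) (auto simp: I_def intro!: divide_pos_pos)
      also have "\<dots> \<le> e" using I that by (simp add: field_simps)
      finally show ?thesis by simp
    qed
    then have "\<bar>\<phi> (y t) - \<phi> (y a) - integral {a..t} w\<bar> \<le> 0" by (rule field_le_epsilon)
    then show ?thesis by simp
  qed
  then show ?thesis using w unfolding ac_def w_def by blast
qed

text \<open>Polarization reduces the product rule to \<open>ac_compose\<close> for squares: 4 x y =
  (x + y)^2 - (x - y)^2. Densities are carried along explicitly, so no differentiation almost
  everywhere is needed.\<close>

lemma ac_mult:
  assumes x: "ac a c x u" and y: "ac a c y v"
  shows "ac a c (\<lambda>t. x t * y t) (\<lambda>t. u t * y t + x t * v t)"
proof -
  have sq: "ac a c (\<lambda>t. (z t)^2) (\<lambda>t. 2 * z t * w t)" if "ac a c z w" for z w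
    by (rule ac_compose[OF that, where \<phi>="\<lambda>z. z^2" and \<phi>'="\<lambda>z. 2*z"])
       (auto intro!: derivative_eq_intros continuous_intros)
  note p = ac_cmult[OF sq[OF ac_add[OF x y]], of "1/4"]
  note m = ac_cmult[OF sq[OF ac_add[OF x ac_cmult[OF y, of "-1"]]], of "-1/4"]
  show ?thesis using ac_add[OF p m]
    by (simp add: algebra_simps power2_eq_square)
qed

lemma absolutely_integrable_const_Icc: "(\<lambda>t. k) absolutely_integrable_on {a..c::real}" for k :: real
  by (intro absolutely_integrable_continuous_real continuous_intros)

text \<open>Domination by |u| + |v|. The measure is general because the bound serves both
  \<open>lborel\<close> (controls) and the Lebesgue measure behind
  \<open>absolutely_integrable_on\<close>.\<close>

lemma set_integrable_hypot:
  fixes u v :: "real \<Rightarrow> real"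
  assumes "set_integrable M A u" "set_integrable M A v"
  shows "set_integrable M A (\<lambda>s. sqrt ((u s)\<^sup>2 + (v s)\<^sup>2))"
proof -
  have eq: "(\<lambda>s. indicator A s *\<^sub>R sqrt ((u s)\<^sup>2 + (v s)\<^sup>2)) =
    (\<lambda>s. sqrt ((indicator A s *\<^sub>R u s)\<^sup>2 + (indicator A s *\<^sub>R v s)\<^sup>2))"
    by (auto simp: indicator_def)
  have "integrable M (\<lambda>s. \<bar>indicator A s *\<^sub>R u s\<bar> + \<bar>indicator A s *\<^sub>R v s\<bar>)"
    using assms unfolding set_integrable_def by auto
  then have "integrable M (\<lambda>s. sqrt ((indicator A s *\<^sub>R u s)\<^sup>2 + (indicator A s *\<^sub>R v s)\<^sup>2))"
  proof (rule Bochner_Integration.integrable_bound)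
    have [measurable]: "(\<lambda>s. indicator A s *\<^sub>R u s) \<in> borel_measurable M"
      "(\<lambda>s. indicator A s *\<^sub>R v s) \<in> borel_measurable M"
      using assms unfolding set_integrable_def by auto
    show "(\<lambda>s. sqrt ((indicator A s *\<^sub>R u s)\<^sup>2 + (indicator A s *\<^sub>R v s)\<^sup>2)) \<in> borel_measurable M"
      by measurable
  qed (auto intro!: AE_I2 sqrt_sum_squares_le_sum_abs)
  then show ?thesis unfolding set_integrable_def eq .
qed

lemma hypot_diff_le:
  "\<bar>sqrt (a\<^sup>2 + b\<^sup>2) - sqrt (c\<^sup>2 + d\<^sup>2)\<bar> \<le> \<bar>a - c\<bar> + \<bar>b - d\<bar>" for a :: real
  using norm_triangle_ineq3[of "Complex a b" "Complex c d"] cmod_le[of "Complex a b - Complex c d"]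
  by (simp add: complex_norm)

text \<open>Applied with the planar speed as \<open>g\<close>: each coordinate moves by at most the
  length of the arc.\<close>

lemma ac_dist_le:
  assumes ac: "ac a c x u" and g: "g integrable_on {r1..r2}" "\<And>s. s \<in> {r1..r2} \<Longrightarrow> \<bar>u s\<bar> \<le> g s"
    and r: "a \<le> r1" "r2 \<le> c" and st: "s \<in> {r1..r2}" "t \<in> {r1..r2}"
  shows "\<bar>x t - x s\<bar> \<le> integral {r1..r2} g"
proof -
  have *: "\<bar>x t - x s\<bar> \<le> integral {r1..r2} g" if "s \<le> t" "s \<in> {r1..r2}" "t \<in> {r1..r2}" for s t
  proof -
    have gi: "g integrable_on {s..t}"
      using g(1) that by (meson atLeastAtMost_iff atLeastatMost_subset_iff integrable_on_subinterval)
    have "norm (integral {s..t} u) \<le> integral {s..t} g"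
      using that r g(2) gi by (intro integral_norm_bound_integral ac_integrable(2)[OF ac]) auto
    also have "\<dots> \<le> integral {r1..r2} g"
      using that g(2) by (intro integral_subset_le gi g) (auto intro: order_trans[OF abs_ge_zero g(2)])
    finally show ?thesis using ac_diff[OF ac, of s t] that r by simp
  qed
  show ?thesis using *[of s t] *[of t s] st by (cases "s \<le> t") (auto simp: abs_minus_commute)
qed


section \<open>Powers of the positive part\<close>

text \<open>Truncation at 0 merges the straight half and the cusp half of an arc into one formula,
  of class C^1 on the whole line when r > 1.\<close>

definition pos_powr :: "real \<Rightarrow> real \<Rightarrow> real" where
  "pos_powr r y = (max y 0) powr r"

lemma pos_powr_nonneg [simp]: "0 \<le> pos_powr r y" by (simp add: pos_powr_def)
lemma pos_powr_nonpos [simp]: "y \<le> 0 \<Longrightarrow> pos_powr r y = 0" by (simp add: pos_powr_def max_def)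
lemma pos_powr_pos: "0 \<le> y \<Longrightarrow> pos_powr r y = y powr r" by (simp add: pos_powr_def)

lemma pos_powr_add: "pos_powr (r + s) y = pos_powr r y * pos_powr s y"
  by (simp add: pos_powr_def powr_add)

lemma pos_powr_le_1: "0 \<le> r \<Longrightarrow> y \<le> 1 \<Longrightarrow> pos_powr r y \<le> 1"
  unfolding pos_powr_def by (rule powr_le1) auto

lemma continuous_pos_powr: "0 < r \<Longrightarrow> continuous_on A (pos_powr r)"
  unfolding pos_powr_def by (auto intro!: continuous_intros continuous_on_powr')

lemma pos_powr_deriv:
  assumes "1 < r" shows "(pos_powr r has_real_derivative r * pos_powr (r - 1) y) (at y)"
proof -
  consider "y > 0" | "y < 0" | "y = 0" by linarith
  then show ?thesis
  proof cases
    case 1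
    have "((\<lambda>y. y powr r) has_real_derivative r * y powr (r - 1)) (at y)"
      using 1 by (rule has_real_derivative_powr)
    then have "(pos_powr r has_real_derivative r * y powr (r - 1)) (at y)"
      by (rule has_field_derivative_transform_within[OF _ 1]) (auto simp: pos_powr_def dist_real_def max_def)
    then show ?thesis using 1 by (simp add: pos_powr_pos)
  next
    case 2
    have "((\<lambda>y. 0) has_real_derivative 0) (at y)" by simp
    then have "(pos_powr r has_real_derivative 0) (at y)"
      by (rule has_field_derivative_transform_within[where d="-y"]) (use 2 in \<open>auto simp: dist_real_def\<close>)
    then show ?thesis using 2 by simp
  next
    case 3
    have "((\<lambda>h. (pos_powr r (0 + h) - pos_powr r 0) / h) \<longlongrightarrow> 0) (at 0)"
    proof (rule Lim_null_comparison)
      have "pos_powr r h / \<bar>h\<bar> = pos_powr (r - 1) h" if "h \<noteq> 0" for h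
        using that pos_powr_add[of "r - 1" 1 h] by (cases "h > 0") (auto simp: pos_powr_pos)
      then show "\<forall>\<^sub>F h in at 0. norm ((pos_powr r (0 + h) - pos_powr r 0) / h) \<le> pos_powr (r - 1) h"
        by (auto simp: eventually_at_filter)
      have "isCont (pos_powr (r - 1)) 0"
        using continuous_pos_powr[of "r - 1" UNIV] assms by (simp add: continuous_on_eq_continuous_at)
      then show "(pos_powr (r - 1) \<longlongrightarrow> 0) (at 0)" unfolding isCont_def by simp
    qed
    then show ?thesis unfolding 3 by (simp add: DERIV_def)
  qed
qed

lemma pos_powr_lipschitz:
  assumes "1 < r" "y \<le> 1" "z \<le> 1" shows "\<bar>pos_powr r y - pos_powr r z\<bar> \<le> r * \<bar>y - z\<bar>"
proof -
  have "norm (pos_powr r y - pos_powr r z) \<le> r * norm (y - z)"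
  proof (rule field_differentiable_bound[where f'="\<lambda>y. r * pos_powr (r - 1) y" and S="{..1}"])
    show "(pos_powr r has_field_derivative r * pos_powr (r - 1) z) (at z within {..1})" for z
      using pos_powr_deriv[OF assms(1)] by (rule has_field_derivative_at_within)
    show "norm (r * pos_powr (r - 1) z) \<le> r" if "z \<in> {..1}" for z
      using pos_powr_le_1[of "r - 1" z] assms that
        mult_left_mono[of "pos_powr (r - 1) z" 1 r] by simp
  qed (use assms in auto)
  then show ?thesis by simp
qed

lemma pos_powr_of_nat: "0 < y \<Longrightarrow> pos_powr (real n) y = y ^ n"
  by (simp add: pos_powr_pos powr_realpow)

text \<open>The two summands have disjoint supports; this is what turns \<open>defect\<close> into a
  sum of squares.\<close>

lemma odd_power_eq_pos_powr:
  assumes "odd b" shows "y ^ b = pos_powr (real b) y - pos_powr (real b) (- y)"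
proof -
  have b: "b > 0" using assms by (rule odd_pos)
  have *: "z powr real b = z ^ b" if "z \<ge> 0" for z :: real
    using that b by (cases "z = 0") (auto simp: powr_realpow zero_power)
  show ?thesis using *[of y] *[of "-y"] assms by (cases "y \<ge> 0") (auto simp: pos_powr_pos)
qed

lemma pos_powr_mult_minus: "pos_powr r y * pos_powr s (- y) = 0"
  by (cases "y \<le> 0") auto

text \<open>With g = x - y^q > 0, the left side is the density of \<open>gain\<close> up to a
  bounded factor and (g (g + 2 y^q))^2 is the defect. For d <= y the part of the defect linear in g
  suffices for Young's inequality; for y < d only the bound g^4 is used. The remainder has the shape
  1 / (d^2 + y^2) because its integral over the whole line is of order 1 / d.\<close>

lemma young_near_cusp:
  fixes y g d :: real
  assumes "2 \<le> q" "0 < y" "0 \<le> g" "0 < d"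
  shows "y powr (q - 2) * g \<le> (g * (g + 2 * y powr q))\<^sup>2 / d powr (2*q+2) + 2 * d powr (2*q) / (d\<^sup>2 + y\<^sup>2)"
proof -
  define Y where "Y = y powr q"
  define D where "D = d powr q"
  have Y: "Y > 0" and D: "D > 0" using assms by (auto simp: Y_def D_def)
  have y2: "y powr (q - 2) = Y / y\<^sup>2" using assms by (simp add: Y_def powr_diff)
  have D2: "d powr (2*q) = D\<^sup>2"
    unfolding D_def power2_eq_square mult_2 by (rule powr_add)
  have d2: "d powr (2*q+2) = D\<^sup>2 * d\<^sup>2" "d powr (2*q) = D\<^sup>2"
    using assms by (simp_all add: powr_add[of d "2*q" 2] D2)
  have pos: "d\<^sup>2 + y\<^sup>2 > 0" "d\<^sup>2 > 0" "y\<^sup>2 > 0" using assms by (simp_all add: add_pos_pos)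
  show ?thesis
  proof (cases "d \<le> y")
    case True
    have dy: "d\<^sup>2 \<le> y\<^sup>2" using True assms by (intro power_mono) auto
    \<comment> \<open>K = d^(q+1) is the Young weight whose square is the prescribed denominator
      d^(2q+2).\<close>
    define K where "K = D * d"
    have K: "K > 0" using D assms by (simp add: K_def)
    have "Y * g / y\<^sup>2 \<le> (Y * g)\<^sup>2 / K\<^sup>2 + K\<^sup>2 / (4 * (y\<^sup>2)\<^sup>2)"
    proof -
      have "0 \<le> (Y * g / K - K / (2 * y\<^sup>2))\<^sup>2" by simp
      also have "\<dots> = (Y * g)\<^sup>2 / K\<^sup>2 + K\<^sup>2 / (4 * (y\<^sup>2)\<^sup>2) - Y * g / y\<^sup>2"
        using K pos by (simp add: power2_diff power_divide power_mult_distrib)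
      finally show ?thesis by simp
    qed
    moreover have "(Y * g)\<^sup>2 / K\<^sup>2 \<le> (g * (g + 2 * Y))\<^sup>2 / K\<^sup>2"
    proof (intro divide_right_mono power_mono)
      have "g * Y \<le> g * (g + 2 * Y)" using assms Y by (intro mult_left_mono) auto
      then show "Y * g \<le> g * (g + 2 * Y)" by (simp add: mult.commute)
    qed (use assms Y in auto)
    moreover have "K\<^sup>2 / (4 * (y\<^sup>2)\<^sup>2) \<le> 2 * D\<^sup>2 / (d\<^sup>2 + y\<^sup>2)"
    proof -
      have "d\<^sup>2 * (d\<^sup>2 + y\<^sup>2) \<le> y\<^sup>2 * (y\<^sup>2 + y\<^sup>2)" using dy by (intro mult_mono) auto
      also have "\<dots> \<le> 8 * (y\<^sup>2)\<^sup>2"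
        unfolding power2_eq_square[of "y\<^sup>2"] distrib_left using zero_le_square[of "y\<^sup>2"] by linarith
      finally have "d\<^sup>2 * (d\<^sup>2 + y\<^sup>2) \<le> 8 * (y\<^sup>2)\<^sup>2" .
      then have "D\<^sup>2 * (d\<^sup>2 * (d\<^sup>2 + y\<^sup>2)) \<le> D\<^sup>2 * (8 * (y\<^sup>2)\<^sup>2)" by (intro mult_left_mono) auto
      then have "(D\<^sup>2 * d\<^sup>2) * (d\<^sup>2 + y\<^sup>2) \<le> (2 * D\<^sup>2) * (4 * (y\<^sup>2)\<^sup>2)" by (simp add: algebra_simps)
      then have "D\<^sup>2 * d\<^sup>2 \<le> (2 * D\<^sup>2) * (4 * (y\<^sup>2)\<^sup>2) / (d\<^sup>2 + y\<^sup>2)"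
        by (rule mult_imp_le_div_pos[OF pos(1)])
      then have "D\<^sup>2 * d\<^sup>2 \<le> 2 * D\<^sup>2 / (d\<^sup>2 + y\<^sup>2) * (4 * (y\<^sup>2)\<^sup>2)" by (simp only: times_divide_eq_left)
      then show ?thesis using pos(3) unfolding K_def power_mult_distrib
        by (intro mult_imp_div_pos_le) auto
    qed
    ultimately have "Y * g / y\<^sup>2 \<le> (g * (g + 2 * Y))\<^sup>2 / K\<^sup>2 + 2 * D\<^sup>2 / (d\<^sup>2 + y\<^sup>2)" by linarith
    then show ?thesis unfolding y2 d2 Y_def[symmetric] K_def power_mult_distrib by simp
  next
    case False
    then have dy: "y\<^sup>2 \<le> d\<^sup>2" using assms by (intro power_mono) auto
    have "y powr (q - 2) \<le> d powr (q - 2)" using False assms by (intro powr_mono2) auto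
    also have "\<dots> = D / d\<^sup>2" using assms by (simp add: D_def powr_diff)
    finally have "y powr (q - 2) * g \<le> D / d\<^sup>2 * g" using assms by (intro mult_right_mono)
    also have "\<dots> \<le> (g^4 + D^4) / (D\<^sup>2 * d\<^sup>2)"
    proof -
      have p4: "z^3 * z = z^4" for z :: real by (simp add: power3_eq_cube power4_eq_xxxx)
      \<comment> \<open>Both sides are homogeneous of degree 4, so the larger of g and D
        decides.\<close>
      have "D^3 * g \<le> g^4 + D^4"
      proof (cases "g \<le> D")
        case True
        have "D^3 * g \<le> D^3 * D" using D True by (intro mult_left_mono) auto
        then show ?thesis using p4[of D] zero_le_power[OF \<open>0 \<le> g\<close>, of 4] by linarith
      next
        case False
        then have "D^3 * g \<le> g^3 * g" using D by (intro mult_right_mono power_mono) auto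
        then show ?thesis using p4[of g] zero_le_power[of D 4] D by linarith
      qed
      then have "D / d\<^sup>2 * g * (D\<^sup>2 * d\<^sup>2) \<le> g^4 + D^4"
        using pos by (simp add: power2_eq_square power3_eq_cube algebra_simps)
      then show ?thesis using D pos by (subst pos_le_divide_eq) auto
    qed
    also have "\<dots> = g^4 / (D\<^sup>2 * d\<^sup>2) + D\<^sup>2 / d\<^sup>2"
      using D pos by (simp add: add_divide_distrib power2_eq_square power4_eq_xxxx)
    also have "g^4 / (D\<^sup>2 * d\<^sup>2) \<le> (g * (g + 2 * Y))\<^sup>2 / (D\<^sup>2 * d\<^sup>2)"
    proof (intro divide_right_mono)
      have "g * g \<le> g * (g + 2 * Y)" using assms Y by (intro mult_left_mono) auto
      then have "(g * g)\<^sup>2 \<le> (g * (g + 2 * Y))\<^sup>2" using assms by (intro power_mono) auto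
      then show "g ^ 4 \<le> (g * (g + 2 * Y))\<^sup>2" by (simp add: power2_eq_square power4_eq_xxxx)
    qed auto
    also have "D\<^sup>2 / d\<^sup>2 \<le> 2 * D\<^sup>2 / (d\<^sup>2 + y\<^sup>2)"
    proof -
      have "D\<^sup>2 * (d\<^sup>2 + y\<^sup>2) \<le> D\<^sup>2 * (2 * d\<^sup>2)" using dy by (intro mult_left_mono) auto
      then have "D\<^sup>2 \<le> D\<^sup>2 * (2 * d\<^sup>2) / (d\<^sup>2 + y\<^sup>2)" by (rule mult_imp_le_div_pos[OF pos(1)])
        then have "D\<^sup>2 \<le> 2 * D\<^sup>2 / (d\<^sup>2 + y\<^sup>2) * d\<^sup>2" by (simp add: mult_ac)
        then show ?thesis by (rule mult_imp_div_pos_le[OF pos(2)])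
    qed
    finally show ?thesis unfolding d2 Y_def[symmetric] by simp
  qed
qed


section \<open>The calibration and the defect\<close>

text \<open>\<open>ell\<close> is an arbitrary antiderivative of the speed of the arc: the additive
  constant is fixed only at the end, where arc length must start at 0, and by then depends on a
  number e obtained inside this locale.\<close>

locale profile =
  fixes b :: nat and q :: real and ell :: "real \<Rightarrow> real"
  assumes b_odd: "odd b" and b_ge: "b \<ge> 5" and q_def: "q = real b / 2"
    and ell_deriv': "\<And>y. (ell has_real_derivative sqrt (1 + (q * pos_powr (q - 1) y)\<^sup>2)) (at y)"
begin

lemma q_ge: "q \<ge> 5/2" using b_ge by (simp add: q_def)
lemma two_q: "2 * q = real b" by (simp add: q_def)

definition "slope y = q * pos_powr (q - 1) y"
definition "speed y = sqrt (1 + (slope y)\<^sup>2)"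
definition "n1 y = slope y / speed y"
text \<open>The curvature of the graph x = y^q, which is also the derivative of
  \<open>n1\<close>.\<close>

definition "dn1 y = q * (q - 1) * pos_powr (q - 2) y / speed y ^ 3"

lemma ell_deriv: "(ell has_real_derivative speed y) (at y)"
  using ell_deriv' by (simp add: speed_def slope_def)

lemma speed_ge: "speed y \<ge> 1" by (simp add: speed_def)
lemma speed_pos: "speed y > 0" using speed_ge[of y] by linarith
lemma speed_sq: "(speed y)\<^sup>2 = 1 + (slope y)\<^sup>2" by (simp add: speed_def)
lemma slope_nonneg: "slope y \<ge> 0" using q_ge by (simp add: slope_def)
lemma slope_nonpos [simp]: "y \<le> 0 \<Longrightarrow> slope y = 0" by (simp add: slope_def)
lemma n1_nonneg: "n1 y \<ge> 0" using slope_nonneg[of y] speed_pos[of y] by (simp add: n1_def)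
lemma n1_le: "n1 y \<le> slope y"
  using slope_nonneg[of y] speed_ge[of y] mult_left_mono[of 1 "speed y" "slope y"]
  by (simp add: n1_def field_simps)
lemma dn1_nonneg: "dn1 y \<ge> 0" using q_ge speed_pos[of y] by (simp add: dn1_def)
lemma dn1_le: "dn1 y \<le> q * (q - 1) * pos_powr (q - 2) y"
proof -
  have "speed y ^ 3 \<ge> 1" using speed_ge[of y] by (rule one_le_power)
  then show ?thesis using q_ge speed_pos[of y]
    mult_left_mono[of 1 "speed y ^ 3" "q * (q - 1) * pos_powr (q - 2) y"]
    by (simp add: dn1_def divide_le_eq)
qed
lemma unit_normal: "(n1 y)\<^sup>2 + (1 / speed y)\<^sup>2 = 1"
  using speed_pos[of y] by (simp add: n1_def power_divide speed_sq divide_simps) (simp add: speed_sq[symmetric])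

lemma slope_deriv: "(slope has_real_derivative q * (q - 1) * pos_powr (q - 2) y) (at y)"
proof -
  have "((\<lambda>y. q * pos_powr (q - 1) y) has_real_derivative q * ((q - 1) * pos_powr (q - 1 - 1) y)) (at y)"
    using q_ge by (intro DERIV_cmult pos_powr_deriv) auto
  then show ?thesis unfolding slope_def[abs_def] by (simp add: algebra_simps)
qed

lemma continuous_slope: "continuous_on A slope"
  using slope_deriv by (meson DERIV_isCont continuous_at_imp_continuous_on)
lemma continuous_speed: "continuous_on A speed"
  unfolding speed_def[abs_def] by (intro continuous_intros continuous_slope)
lemma continuous_n1: "continuous_on A n1"
  unfolding n1_def[abs_def] using speed_pos
  by (intro continuous_intros continuous_slope continuous_speed) (auto simp: less_imp_neq[symmetric])
lemma continuous_inv_speed: "continuous_on A (\<lambda>y. 1 / speed y)"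
  using speed_pos by (intro continuous_intros continuous_speed) (auto simp: less_imp_neq[symmetric])
lemma continuous_dn1: "continuous_on A dn1"
  unfolding dn1_def[abs_def] using speed_pos q_ge
  by (intro continuous_intros continuous_speed continuous_pos_powr) (auto simp: less_imp_neq[symmetric])

lemma n1_deriv: "(n1 has_real_derivative dn1 y) (at y)"
proof -
  let ?s' = "q * (q - 1) * pos_powr (q - 2) y"
  have sp: "(speed has_real_derivative slope y * ?s' / speed y) (at y)"
  proof -
    have "((\<lambda>y. 1 + (slope y)\<^sup>2) has_real_derivative 2 * slope y * ?s') (at y)"
      using DERIV_add[OF DERIV_const DERIV_power[OF slope_deriv, of 2], of 1 y] by (simp add: mult_ac)
    then have "((\<lambda>y. sqrt (1 + (slope y)\<^sup>2)) has_real_derivative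
        inverse (sqrt (1 + (slope y)\<^sup>2)) / 2 * (2 * slope y * ?s')) (at y)"
      by (rule DERIV_chain2[OF DERIV_real_sqrt, rotated]) (simp add: add_pos_nonneg)
    then have "(speed has_real_derivative inverse (speed y) / 2 * (2 * slope y * ?s')) (at y)"
      unfolding speed_def[symmetric] .
    moreover have "inverse (speed y) / 2 * (2 * w) = w / speed y" for w
      using speed_pos[of y] by (simp add: field_simps)
    ultimately show ?thesis by (metis mult.assoc)
  qed
  have "((\<lambda>y. slope y / speed y) has_real_derivative
     (?s' * speed y - slope y * (slope y * ?s' / speed y)) / (speed y * speed y)) (at y)"
    using speed_pos[of y] by (intro DERIV_divide slope_deriv sp) auto
  moreover have "(?s' * speed y - slope y * (slope y * ?s' / speed y)) / (speed y * speed y) = dn1 y"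
  proof -
    have "?s' * speed y - slope y * (slope y * ?s' / speed y) = ?s' * ((speed y)\<^sup>2 - (slope y)\<^sup>2) / speed y"
      using speed_pos[of y] by (simp add: divide_simps power2_eq_square algebra_simps)
    also have "\<dots> = ?s' / speed y" by (simp add: speed_sq)
    finally show ?thesis using speed_pos[of y] by (simp add: dn1_def power3_eq_cube)
  qed
  ultimately show ?thesis by (simp add: n1_def[abs_def])
qed

text \<open>The field \<open>(n1 y, 1 / speed y)\<close> is the unit tangent of \<open>x = pos_powr q y\<close>, extended
  independently of \<open>x\<close>; it fails to be closed by the term with \<open>dn1\<close>.\<close>
lemma calibration:
  assumes x: "ac a c x u" and y: "ac a c y v" and "a \<le> c"
  shows "integral {a..c} (\<lambda>t. (n1 (y t) * u t + 1 / speed (y t) * v t) + dn1 (y t) * (x t - pos_powr q (y t)) * v t)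
    = (n1 (y c) * (x c - pos_powr q (y c)) + ell (y c)) - (n1 (y a) * (x a - pos_powr q (y a)) + ell (y a))"
proof -
  have 1: "ac a c (\<lambda>t. n1 (y t)) (\<lambda>t. dn1 (y t) * v t)"
    by (rule ac_compose[OF y n1_deriv continuous_dn1])
  have 2: "ac a c (\<lambda>t. pos_powr q (y t)) (\<lambda>t. slope (y t) * v t)"
    by (rule ac_compose[OF y _ continuous_slope]) (use q_ge in \<open>simp add: slope_def pos_powr_deriv\<close>)
  have 3: "ac a c (\<lambda>t. ell (y t)) (\<lambda>t. speed (y t) * v t)"
    by (rule ac_compose[OF y ell_deriv continuous_speed])
  note 4 = ac_add[OF ac_mult[OF 1 ac_add[OF x ac_cmult[OF 2, of "-1"]]] 3]
  \<comment> \<open>This is the total differential of n1(y) (x - y^q) + ell(y): beyond the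
    calibrating form only the curvature term remains.\<close>
  have 5: "(n1 (y t) * u t + 1 / speed (y t) * v t) + dn1 (y t) * (x t - pos_powr q (y t)) * v t
     = dn1 (y t) * v t * (x t + - 1 * pos_powr q (y t)) + n1 (y t) * (u t + - 1 * (slope (y t) * v t)) + speed (y t) * v t" for t
  proof -
    have "speed (y t) - n1 (y t) * slope (y t) = 1 / speed (y t)"
      using speed_pos[of "y t"] speed_sq[of "y t"] by (simp add: n1_def divide_simps power2_eq_square)
    then have "1 / speed (y t) * v t = (speed (y t) - n1 (y t) * slope (y t)) * v t" by simp
    then show ?thesis by (simp add: algebra_simps)
  qed
  have "integral {a..c} (\<lambda>t. (n1 (y t) * u t + 1 / speed (y t) * v t) + dn1 (y t) * (x t - pos_powr q (y t)) * v t)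
    = (n1 (y c) * (x c + - 1 * pos_powr q (y c)) + ell (y c)) - (n1 (y a) * (x a + - 1 * pos_powr q (y a)) + ell (y a))"
    unfolding 5 using \<open>a \<le> c\<close> by (intro ac_diff[OF 4, symmetric]) auto
  then show ?thesis by simp
qed

text \<open>Cauchy-Schwarz with the unit vector of \<open>unit_normal\<close>. The form with |v|
  matters for backward motion, where passing from |v| to v gives up a further 2 |v| / speed.\<close>

lemma calibration_le:
  "n1 y * u + 1 / speed y * \<bar>v\<bar> \<le> sqrt (u\<^sup>2 + v\<^sup>2)"
proof -
  have "n1 y * u + 1 / speed y * \<bar>v\<bar> \<le> sqrt (((n1 y)\<^sup>2 + (1 / speed y)\<^sup>2) * (u\<^sup>2 + \<bar>v\<bar>\<^sup>2))"
  proof (rule real_le_rsqrt)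
    have "(p\<^sup>2 + r\<^sup>2) * (u\<^sup>2 + w\<^sup>2) - (p * u + r * w)\<^sup>2 = (p * w - r * u)\<^sup>2" for p r w :: real
      by (simp add: power2_eq_square algebra_simps)
    then show "(n1 y * u + 1 / speed y * \<bar>v\<bar>)\<^sup>2 \<le> ((n1 y)\<^sup>2 + (1 / speed y)\<^sup>2) * (u\<^sup>2 + \<bar>v\<bar>\<^sup>2)"
      by (metis diff_ge_0_iff_ge zero_le_power2)
  qed
  then show ?thesis by (simp only: unit_normal) simp
qed

text \<open>The density \<open>(pos_powr b (- y))\<^sup>2\<close> integrates against \<open>dy\<close> to the height of \<open>\<gamma>\<close>, so for
  competitors with the same end points the integral of the defect against \<open>dy\<close> vanishes.\<close>
definition "defect x y = (x\<^sup>2 - y ^ b)\<^sup>2 - (pos_powr (real b) (- y))\<^sup>2"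

text \<open>For y < 0 the defect is (x^2 + |y|^b)^2 - |y|^(2b) = x^4 + 2 x^2 |y|^b, and |y|^b is the
  square of |y|^q. So the square root of the defect is the norm of a pair of locally Lipschitz
  functions.\<close>

lemma defect_eq:
  "defect x y = (x\<^sup>2 - pos_powr (real b) y)\<^sup>2 + (sqrt 2 * x * pos_powr q (- y))\<^sup>2"
proof -
  have "(pos_powr q (- y))\<^sup>2 = pos_powr (real b) (- y)"
    using pos_powr_add[of q q "-y"] two_q by (simp add: power2_eq_square)
  then show ?thesis
    using pos_powr_mult_minus[of "real b" y "real b"]
    unfolding defect_def odd_power_eq_pos_powr[OF b_odd] power_mult_distrib
    by (simp add: power2_eq_square algebra_simps)
qed

lemma defect_nonneg: "defect x y \<ge> 0" by (simp add: defect_eq)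

text \<open>The two components contribute 2 + b and 2 (q + 1) = b + 2 to the constant. Working with
  the square root turns a distance of order \<open>gain\<close> into a defect of order
  \<open>gain\<close> squared.\<close>

lemma sqrt_defect_lipschitz:
  assumes "\<bar>x\<bar> \<le> 1" "\<bar>x'\<bar> \<le> 1" "\<bar>y\<bar> \<le> 1" "\<bar>y'\<bar> \<le> 1" and d: "\<bar>x - x'\<bar> \<le> d" "\<bar>y - y'\<bar> \<le> d"
  shows "\<bar>sqrt (defect x y) - sqrt (defect x' y')\<bar> \<le> 4 * real b * d"
proof -
  have d0: "d \<ge> 0" using d by linarith
  have 1: "\<bar>x\<^sup>2 - x'\<^sup>2\<bar> \<le> 2 * d"
  proof -
    have "\<bar>x\<^sup>2 - x'\<^sup>2\<bar> = \<bar>x + x'\<bar> * \<bar>x - x'\<bar>" by (simp add: abs_mult[symmetric] power2_eq_square algebra_simps)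
    also have "\<dots> \<le> 2 * d" using assms by (intro mult_mono) auto
    finally show ?thesis .
  qed
  have 2: "\<bar>pos_powr (real b) y - pos_powr (real b) y'\<bar> \<le> real b * d"
    using b_ge assms d by (intro order_trans[OF pos_powr_lipschitz] mult_left_mono) auto
  have 3: "\<bar>pos_powr q (-y) - pos_powr q (-y')\<bar> \<le> q * d"
    using q_ge assms d by (intro order_trans[OF pos_powr_lipschitz] mult_left_mono) auto
  have 4: "\<bar>sqrt 2 * x * pos_powr q (-y) - sqrt 2 * x' * pos_powr q (-y')\<bar> \<le> 2 * (q * d + d)"
  proof -
    have "x * pos_powr q (-y) - x' * pos_powr q (-y') =
       x * (pos_powr q (-y) - pos_powr q (-y')) + (x - x') * pos_powr q (-y')" by (simp add: algebra_simps)
    then have "\<bar>x * pos_powr q (-y) - x' * pos_powr q (-y')\<bar> \<le>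
       \<bar>x\<bar> * \<bar>pos_powr q (-y) - pos_powr q (-y')\<bar> + \<bar>x - x'\<bar> * pos_powr q (-y')"
      by (metis abs_mult abs_of_nonneg abs_triangle_ineq pos_powr_nonneg)
    also have "\<dots> \<le> 1 * (q * d) + d * 1"
      using assms 3 d q_ge by (intro add_mono mult_mono pos_powr_le_1) auto
    finally have A: "\<bar>x * pos_powr q (-y) - x' * pos_powr q (-y')\<bar> \<le> q * d + d" by simp
    have "sqrt 2 * \<bar>x * pos_powr q (-y) - x' * pos_powr q (-y')\<bar> \<le> 2 * (q * d + d)"
      using A by (intro mult_mono) (auto intro: real_le_lsqrt)
    moreover have "\<bar>sqrt 2 * x * pos_powr q (-y) - sqrt 2 * x' * pos_powr q (-y')\<bar>
      = sqrt 2 * \<bar>x * pos_powr q (-y) - x' * pos_powr q (-y')\<bar>"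
      by (simp add: abs_mult mult.assoc flip: right_diff_distrib)
    ultimately show ?thesis by simp
  qed
  have "\<bar>sqrt (defect x y) - sqrt (defect x' y')\<bar> \<le>
      \<bar>(x\<^sup>2 - pos_powr (real b) y) - (x'\<^sup>2 - pos_powr (real b) y')\<bar>
      + \<bar>sqrt 2 * x * pos_powr q (-y) - sqrt 2 * x' * pos_powr q (-y')\<bar>"
    unfolding defect_eq by (rule hypot_diff_le)
  also have "\<dots> \<le> (2 * d + real b * d) + 2 * (q * d + d)" using 1 2 4 by linarith
  also have "\<dots> = (2 * real b + 4) * d" using two_q by (simp add: algebra_simps)
  also have "\<dots> \<le> 4 * real b * d" using b_ge d0 by (intro mult_right_mono) auto
  finally show ?thesis .
qed

end

section \<open>Competitors shorter than the calibrated length\<close>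

text \<open>The data of a hypothetical counterexample, headed for the contradiction in
  \<open>gain_not_small\<close>. The end points enter only through \<open>short\<close> and
  \<open>defect_0\<close>; the bounds 1/2 and 1/100 are convenient numbers, later ensured by
  confinement to a small box.\<close>

locale short_curve = profile +
  fixes a c :: real and x y u v :: "real \<Rightarrow> real"
  assumes a_le_c: "a \<le> c" and ac_x: "ac a c x u" and ac_y: "ac a c y v"
    and x_le: "\<And>t. t \<in> {a..c} \<Longrightarrow> \<bar>x t\<bar> \<le> 1" and y_le: "\<And>t. t \<in> {a..c} \<Longrightarrow> \<bar>y t\<bar> \<le> 1"
    and slope_le: "\<And>t. t \<in> {a..c} \<Longrightarrow> slope (y t) \<le> 1/2"
    and dn1_small: "\<And>t. t \<in> {a..c} \<Longrightarrow> dn1 (y t) * \<bar>x t - pos_powr q (y t)\<bar> \<le> 1/100"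
    and defect_0: "integral {a..c} (\<lambda>t. defect (x t) (y t) * v t) = 0"
    and short: "integral {a..c} (\<lambda>t. sqrt ((u t)\<^sup>2 + (v t)\<^sup>2)) <
      (n1 (y c) * (x c - pos_powr q (y c)) + ell (y c)) - (n1 (y a) * (x a - pos_powr q (y a)) + ell (y a))"
begin

definition "excess t = sqrt ((u t)\<^sup>2 + (v t)\<^sup>2) - (n1 (y t) * u t + 1 / speed (y t) * v t)"
text \<open>\<open>v t + back t\<close> is the positive part of the vertical velocity, which is how
  forward motion is written below.\<close>

definition "back t = max (- v t) 0"
definition "gain = integral {a..c} (\<lambda>t. dn1 (y t) * (x t - pos_powr q (y t)) * v t)"

lemma back_nonneg: "back t \<ge> 0" by (simp add: back_def)

lemma u_int: "u absolutely_integrable_on {a..c}" and v_int: "v absolutely_integrable_on {a..c}"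
  using ac_x ac_y by (simp_all add: ac_def)

lemma back_int: "back absolutely_integrable_on {a..c}"
proof -
  have "(\<lambda>t. - 1 * v t) absolutely_integrable_on {a..c}"
    by (intro set_integrable_mult_right) (rule v_int)
  then show ?thesis unfolding back_def[abs_def]
    by (intro absolutely_integrable_max_1 absolutely_integrable_const_Icc) simp
qed

lemma abs_v_int: "(\<lambda>t. \<bar>v t\<bar>) absolutely_integrable_on {a..c}"
  using v_int by (rule set_integrable_abs)

lemma speed_int: "(\<lambda>t. sqrt ((u t)\<^sup>2 + (v t)\<^sup>2)) absolutely_integrable_on {a..c}"
  by (intro set_integrable_hypot u_int v_int)

lemma cont_mult_int:
  fixes f w :: "real \<Rightarrow> real"
  assumes "continuous_on {a..c} f" "w absolutely_integrable_on {a..c}"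
  shows "(\<lambda>t. f t * w t) integrable_on {a..c}"
  using absolutely_integrable_continuous_mult[OF assms] absolutely_integrable_on_def by blast

lemma cont_x: "continuous_on {a..c} x" and cont_y: "continuous_on {a..c} y"
  by (rule ac_continuous, rule ac_x, rule ac_continuous, rule ac_y)

lemma cont_comp: "continuous_on UNIV f \<Longrightarrow> continuous_on {a..c} (\<lambda>t. f (y t))"
  by (rule continuous_on_compose2[OF _ cont_y]) auto

lemma cont_defect: "continuous_on {a..c} (\<lambda>t. defect (x t) (y t))"
proof -
  have "continuous_on {a..c} (\<lambda>t. pos_powr (real b) (- y t))"
    by (rule continuous_on_compose2[OF continuous_pos_powr[of "real b" UNIV]])
       (use b_ge in \<open>auto intro!: continuous_intros cont_y\<close>)
  then show ?thesis unfolding defect_def by (intro continuous_intros cont_x cont_y)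
qed

lemma calib_int: "(\<lambda>t. n1 (y t) * u t + 1 / speed (y t) * v t) integrable_on {a..c}"
  by (intro integrable_add cont_mult_int u_int v_int cont_comp continuous_n1 continuous_inv_speed)

lemma gain_int: "(\<lambda>t. dn1 (y t) * (x t - pos_powr q (y t)) * v t) integrable_on {a..c}"
  using q_ge by (intro cont_mult_int v_int continuous_intros cont_comp continuous_dn1 cont_x continuous_pos_powr) auto

lemma excess_int: "excess integrable_on {a..c}"
  unfolding excess_def[abs_def] using speed_int calib_int
  by (intro integrable_diff) (auto simp: absolutely_integrable_on_def)

text \<open>The length is the integral of the calibrating form plus that of \<open>excess\<close>,
  and the former is the end point difference minus \<open>gain\<close>; \<open>short\<close>
  compares the two.\<close>

lemma excess_lt_gain: "integral {a..c} excess < gain"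
proof -
  have S: "(\<lambda>t. sqrt ((u t)\<^sup>2 + (v t)\<^sup>2)) integrable_on {a..c}"
    using speed_int by (auto simp: absolutely_integrable_on_def)
  have "integral {a..c} excess = integral {a..c} (\<lambda>t. sqrt ((u t)\<^sup>2 + (v t)\<^sup>2))
      - integral {a..c} (\<lambda>t. n1 (y t) * u t + 1 / speed (y t) * v t)"
    unfolding excess_def[abs_def] by (rule integral_diff[OF S calib_int])
  moreover have "integral {a..c} (\<lambda>t. n1 (y t) * u t + 1 / speed (y t) * v t) + gain =
      (n1 (y c) * (x c - pos_powr q (y c)) + ell (y c)) - (n1 (y a) * (x a - pos_powr q (y a)) + ell (y a))"
    unfolding calibration[OF ac_x ac_y a_le_c, symmetric] gain_def
    by (rule integral_add[OF calib_int gain_int, symmetric])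
  ultimately show ?thesis using short by linarith
qed

lemma inv_speed_ge: assumes "t \<in> {a..c}" shows "1 / speed (y t) \<ge> 1/2"
proof -
  have "(slope (y t))\<^sup>2 \<le> 1\<^sup>2" using slope_le[OF assms] slope_nonneg by (intro power_mono) auto
  then have "speed (y t) \<le> 2" unfolding speed_def by (intro real_le_lsqrt) auto
  then show ?thesis using speed_pos[of "y t"] by (simp add: field_simps)
qed

text \<open>For v < 0 the vertical term of the calibration has the wrong sign, so the excess is at
  least 2 |v| / speed, while the speed is at most 2.\<close>

lemma back_le_excess: assumes "t \<in> {a..c}" shows "back t \<le> excess t"
proof (cases "v t \<ge> 0")
  case True
  then show ?thesis using calibration_le[of "y t" "u t" "v t"] by (simp add: excess_def back_def)
next
  case False
  have "1/2 * (- v t) \<le> 1 / speed (y t) * (- v t)"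
    using inv_speed_ge[OF assms] False by (intro mult_right_mono) auto
  moreover have "n1 (y t) * u t + 1 / speed (y t) * (- v t) \<le> sqrt ((u t)\<^sup>2 + (v t)\<^sup>2)"
    using calibration_le[of "y t" "u t" "v t"] False by simp
  moreover have "- w \<le> S - (p + r * w)" if "1/2 * (- w) \<le> r * (- w)" "p + r * (- w) \<le> S" for p r w S :: real
    using that unfolding mult_minus_right by linarith
  ultimately have "- v t \<le> excess t" unfolding excess_def by blast
  then show ?thesis using False by (simp add: back_def)
qed

lemma excess_nonneg: "t \<in> {a..c} \<Longrightarrow> excess t \<ge> 0"
  using back_le_excess back_nonneg order_trans by blast

lemma back_integrable: "back integrable_on {a..c}"
  using back_int by (simp add: absolutely_integrable_on_def)

lemma integral_back_le: "integral {a..c} back \<le> gain"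
proof -
  have "integral {a..c} back \<le> integral {a..c} excess"
    by (intro integral_le back_integrable excess_int back_le_excess)
  then show ?thesis using excess_lt_gain by simp
qed

lemma gain_pos: "gain > 0"
proof -
  have "integral {a..c} excess \<ge> 0" by (intro integral_nonneg excess_int excess_nonneg)
  then show ?thesis using excess_lt_gain by simp
qed

text \<open>Since \<open>n1\<close> is at most 1/2 here, the horizontal term of the calibration
  accounts for at most half of the speed; the rest is excess or vertical motion.\<close>

lemma speed_le: assumes "t \<in> {a..c}"
  shows "sqrt ((u t)\<^sup>2 + (v t)\<^sup>2) \<le> 2 * (excess t + \<bar>v t\<bar>)"
proof -
  let ?S = "sqrt ((u t)\<^sup>2 + (v t)\<^sup>2)"
  have "n1 (y t) * u t \<le> 1/2 * ?S"
  proof -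
    have "n1 (y t) * u t \<le> n1 (y t) * \<bar>u t\<bar>" by (intro mult_left_mono n1_nonneg) auto
    also have "\<dots> \<le> 1/2 * ?S"
      using n1_le[of "y t"] slope_le[OF assms] by (intro mult_mono) (auto intro: real_le_rsqrt)
    finally show ?thesis .
  qed
  moreover have "1 / speed (y t) * v t \<le> \<bar>v t\<bar>"
  proof -
    have "1 / speed (y t) * v t \<le> 1 / speed (y t) * \<bar>v t\<bar>"
      using speed_pos[of "y t"] by (intro mult_left_mono) auto
    also have "\<dots> \<le> 1 * \<bar>v t\<bar>" using speed_ge[of "y t"] by (intro mult_right_mono) auto
    finally show ?thesis by simp
  qed
  moreover have "S \<le> 2 * ((S - (p + r)) + w)" if "p \<le> 1/2 * S" "r \<le> w" for p r w S :: real
    using that by (simp add: algebra_simps)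
  ultimately show ?thesis unfolding excess_def by blast
qed

text \<open>Where the defect is maximal, the curve cannot leave the region of comparable defect within vertical
  variation \<open>9 * gain\<close>; but the constraint \<open>defect_0\<close> balances all forward motion in that region by
  backward motion, of which there is at most \<open>gain\<close>.\<close>
lemma defect_le:
  assumes var: "18 * gain \<le> integral {a..c} (\<lambda>t. \<bar>v t\<bar>)" and t: "t \<in> {a..c}"
  shows "defect (x t) (y t) \<le> (160 * real b * gain)\<^sup>2"
proof -
  define f where "f = (\<lambda>t. defect (x t) (y t))"
  define W where "W = (\<lambda>t. integral {a..t} (\<lambda>t. \<bar>v t\<bar>))"
  have f0: "f t \<ge> 0" for t by (simp add: f_def defect_nonneg)
  have cf: "continuous_on {a..c} f" unfolding f_def by (rule cont_defect)
  have av: "(\<lambda>t. \<bar>v t\<bar>) integrable_on {a..c}" using abs_v_int by (simp add: absolutely_integrable_on_def)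
  have cW: "continuous_on {a..c} W" unfolding W_def by (rule indefinite_integral_continuous_1[OF av])
  obtain t0 where t0: "t0 \<in> {a..c}" "\<And>t. t \<in> {a..c} \<Longrightarrow> f t \<le> f t0"
    using continuous_attains_sup[OF compact_Icc _ cf] a_le_c by (metis atLeastAtMost_iff empty_iff order_refl)
  define M where "M = f t0"
  have "M \<le> (160 * real b * gain)\<^sup>2"
  proof (rule ccontr)
    assume "\<not> M \<le> (160 * real b * gain)\<^sup>2"
    then have big: "sqrt M > 160 * real b * gain" by (simp add: real_less_rsqrt)
    have bg: "160 * real b * gain > 0" using gain_pos b_ge by simp
    then have M: "M > 0" using big by (meson less_trans real_sqrt_gt_0_iff)
    have Wd: "integral {r1..r2} (\<lambda>t. \<bar>v t\<bar>) = W r2 - W r1" if "a \<le> r1" "r1 \<le> r2" "r2 \<le> c" for r1 r2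
    proof -
      have "(\<lambda>t. \<bar>v t\<bar>) integrable_on {a..r2}"
        using av that by (meson atLeastatMost_subset_iff integrable_on_subinterval order_refl)
      from Henstock_Kurzweil_Integration.integral_combine[OF that(1,2) this]
      show ?thesis unfolding W_def by simp
    qed
    \<comment> \<open>A total variation of 18 \<open>gain\<close> leaves 9 \<open>gain\<close> on
      one side of the maximum point \<open>t0\<close>; the window ends or begins there.\<close>
    have "\<exists>r1 r2. a \<le> r1 \<and> r1 \<le> r2 \<and> r2 \<le> c \<and> t0 \<in> {r1..r2} \<and> W r2 - W r1 = 9 * gain"
    proof (cases "W t0 \<ge> 9 * gain")
      case True
      have "\<exists>r\<ge>a. r \<le> t0 \<and> W r = W t0 - 9 * gain"
        using True t0 gain_pos
        by (intro IVT') (auto simp: W_def intro: continuous_on_subset[OF cW[unfolded W_def]])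
      then obtain r where "a \<le> r" "r \<le> t0" "W r = W t0 - 9 * gain" by blast
      then show ?thesis using t0 by (intro exI[of _ r] exI[of _ t0]) auto
    next
      case False
      have "\<exists>r\<ge>t0. r \<le> c \<and> W r = W t0 + 9 * gain"
        using False t0 gain_pos var
        by (intro IVT') (auto simp: W_def intro: continuous_on_subset[OF cW[unfolded W_def]])
      then obtain r where "t0 \<le> r" "r \<le> c" "W r = W t0 + 9 * gain" by blast
      then show ?thesis using t0 by (intro exI[of _ t0] exI[of _ r]) auto
    qed
    then obtain r1 r2 where r: "a \<le> r1" "r1 \<le> r2" "r2 \<le> c" "t0 \<in> {r1..r2}"
      and W9: "integral {r1..r2} (\<lambda>t. \<bar>v t\<bar>) = 9 * gain" using Wd by metis
    have sub: "{r1..r2} \<subseteq> {a..c}" using r by auto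
    let ?S = "\<lambda>t. sqrt ((u t)\<^sup>2 + (v t)\<^sup>2)"
    have S: "?S integrable_on {r1..r2}"
      using speed_int integrable_on_subinterval[OF _ sub] by (simp add: absolutely_integrable_on_def)
    have exi: "excess integrable_on {r1..r2}" by (rule integrable_on_subinterval[OF excess_int sub])
    have avi: "(\<lambda>t. \<bar>v t\<bar>) integrable_on {r1..r2}" by (rule integrable_on_subinterval[OF av sub])
    \<comment> \<open>20 = 2 (1 + 9): excess below \<open>gain\<close>, variation 9
      \<open>gain\<close>.\<close>
    have len: "integral {r1..r2} ?S \<le> 20 * gain"
    proof -
      have "integral {r1..r2} ?S \<le> integral {r1..r2} (\<lambda>t. 2 * (excess t + \<bar>v t\<bar>))"
        using sub by (intro integral_le S integrable_on_mult_right integrable_add exi avi speed_le) auto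
      also have "\<dots> = 2 * (integral {r1..r2} excess + 9 * gain)"
        by (simp only: integral_mult_right integral_add[OF exi avi] W9)
      also have "integral {r1..r2} excess \<le> integral {a..c} excess"
        by (rule integral_subset_le[OF sub exi excess_int]) (auto intro: excess_nonneg)
      finally show ?thesis using excess_lt_gain by simp
    qed
    \<comment> \<open>Across the window the root of the defect varies by at most 4 b times 20
      \<open>gain\<close>, less than half of \<open>sqrt M\<close>; hence the constant 160.\<close>
    have quarter: "M / 4 \<le> f t" if t: "t \<in> {r1..r2}" for t
    proof -
      have "\<bar>x t - x t0\<bar> \<le> integral {r1..r2} ?S"
        by (rule ac_dist_le[OF ac_x S _ r(1,3) r(4) t]) (rule real_le_rsqrt, simp)
      moreover have "\<bar>y t - y t0\<bar> \<le> integral {r1..r2} ?S"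
        by (rule ac_dist_le[OF ac_y S _ r(1,3) r(4) t]) (rule real_le_rsqrt, simp)
      ultimately have "\<bar>sqrt (defect (x t) (y t)) - sqrt (defect (x t0) (y t0))\<bar> \<le> 4 * real b * (20 * gain)"
        using t sub t0 len by (intro sqrt_defect_lipschitz x_le y_le) auto
      then have "sqrt M - sqrt (f t) \<le> 80 * real b * gain" unfolding M_def f_def by simp
      then have "sqrt (f t) \<ge> sqrt M / 2" using big by linarith
      then have "(sqrt M / 2)\<^sup>2 \<le> (sqrt (f t))\<^sup>2" using M by (intro power_mono) auto
      then show ?thesis using M f0[of t] by (simp add: power_divide)
    qed
    have fvi: "(\<lambda>t. f t * \<bar>v t\<bar>) integrable_on {a..c}" by (intro cont_mult_int cf abs_v_int)
    \<comment> \<open>As |v| = v + 2 \<open>back\<close>, the constraint bounds the integral of f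
      |v| by 2 M \<open>gain\<close>, while the window alone gives (9/4) M \<open>gain\<close>; the
      number 9 only has to exceed 8.\<close>
    have "9 * gain * (M / 4) = integral {r1..r2} (\<lambda>t. M / 4 * \<bar>v t\<bar>)" using W9 by simp
    also have "\<dots> \<le> integral {r1..r2} (\<lambda>t. f t * \<bar>v t\<bar>)"
      by (intro integral_le integrable_on_mult_right avi mult_right_mono quarter
            integrable_on_subinterval[OF fvi sub]) auto
    also have "\<dots> \<le> integral {a..c} (\<lambda>t. f t * \<bar>v t\<bar>)"
      by (intro integral_subset_le sub fvi integrable_on_subinterval[OF fvi sub]) (simp add: f0)
    also have "\<dots> = integral {a..c} (\<lambda>t. f t * v t + 2 * (f t * back t))"
      by (intro Henstock_Kurzweil_Integration.integral_cong) (auto simp: back_def max_def abs_if)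
    also have "\<dots> = integral {a..c} (\<lambda>t. f t * v t) + 2 * integral {a..c} (\<lambda>t. f t * back t)"
      by (subst integral_add) (auto intro!: cont_mult_int cf v_int back_int)
    also have "integral {a..c} (\<lambda>t. f t * v t) = 0" using defect_0 by (simp add: f_def)
    also have "integral {a..c} (\<lambda>t. f t * back t) \<le> integral {a..c} (\<lambda>t. M * back t)"
      using t0 by (intro integral_le cont_mult_int cf back_int integrable_on_mult_right back_integrable
          mult_right_mono back_nonneg) (auto simp: M_def)
    also have "\<dots> = M * integral {a..c} back" by simp
    also have "\<dots> \<le> M * gain" using M by (intro mult_left_mono integral_back_le) auto
    finally have "9 * gain * (M / 4) \<le> 2 * (M * gain)" by simp
    moreover have "M * gain > 0" using M gain_pos by simp
    ultimately show False by simp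
  qed
  then show ?thesis using t0(2)[OF t] unfolding M_def f_def by simp
qed

text \<open>Forward motion is estimated by \<open>young_near_cusp\<close> where y > 0 and x > y^q,
  and contributes nothing positive elsewhere. Backward motion needs only the crude bound
  \<open>dn1_small\<close>, since its total is at most \<open>gain\<close>.\<close>

lemma gain_integrand_le:
  assumes t: "t \<in> {a..c}" and d: "d > 0"
  defines "k \<equiv> q * (q - 1)"
  shows "dn1 (y t) * (x t - pos_powr q (y t)) * v t
    \<le> k / d ^ (b+2) * (defect (x t) (y t) * (v t + back t))
      + 2 * k * d ^ b * (1 / (d\<^sup>2 + (y t)\<^sup>2) * (v t + back t)) + 1/100 * back t"
proof (cases "v t \<ge> 0")
  case True
  then have b0: "back t = 0" by (simp add: back_def)
  have k: "k > 0" using q_ge by (simp add: k_def)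
  have den: "d\<^sup>2 + (y t)\<^sup>2 > 0" using d by (simp add: add_pos_nonneg)
  define R where "R = defect (x t) (y t) / d ^ (b+2) + 2 * d ^ b / (d\<^sup>2 + (y t)\<^sup>2)"
  have R: "R \<ge> 0" using d den by (simp add: R_def defect_nonneg)
  have "dn1 (y t) * (x t - pos_powr q (y t)) \<le> k * R"
  proof (cases "y t > 0 \<and> x t - pos_powr q (y t) > 0")
    case pos: True
    define g where "g = x t - pos_powr q (y t)"
    have Y: "pos_powr q (y t) = y t powr q" using pos by (simp add: pos_powr_pos)
    have YY: "pos_powr (real b) (y t) = (y t powr q)\<^sup>2"
      using pos_powr_add[of q q "y t"] two_q by (simp add: power2_eq_square Y)
    have def: "defect (x t) (y t) = (g * (g + 2 * y t powr q))\<^sup>2"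
    proof -
      have "g * (g + 2 * y t powr q) = (x t)\<^sup>2 - (y t powr q)\<^sup>2"
        by (simp add: g_def Y power2_eq_square algebra_simps)
      then show ?thesis using pos unfolding defect_eq YY by simp
    qed
    have dp: "d powr (2*q+2) = d ^ (b+2)" "d powr (2*q) = d ^ b"
      using d powr_realpow[of d "b+2"] powr_realpow[of d b] by (simp_all add: two_q add.commute)
    have "dn1 (y t) * g \<le> k * pos_powr (q - 2) (y t) * g"
      using dn1_le[of "y t"] pos by (intro mult_right_mono) (auto simp: g_def k_def)
    also have "\<dots> = k * (y t powr (q - 2) * g)" using pos by (simp add: pos_powr_pos)
    also have "y t powr (q - 2) * g \<le> R"
      using young_near_cusp[of q "y t" g d] pos d q_ge unfolding R_def def dp[symmetric] by (simp add: g_def)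
    finally show ?thesis using k by (simp add: g_def)
  next
    case False
    then have "dn1 (y t) = 0 \<or> x t - pos_powr q (y t) \<le> 0" by (auto simp: dn1_def)
    then have "dn1 (y t) * (x t - pos_powr q (y t)) \<le> 0"
      using mult_nonneg_nonpos[OF dn1_nonneg[of "y t"]] by auto
    then show ?thesis using k R by (meson less_imp_le mult_nonneg_nonneg order_trans)
  qed
  then have "dn1 (y t) * (x t - pos_powr q (y t)) * v t \<le> k * R * v t"
    using True by (rule mult_right_mono)
  also have "\<dots> = k / d ^ (b+2) * (defect (x t) (y t) * v t) + 2 * k * d ^ b * (1 / (d\<^sup>2 + (y t)\<^sup>2) * v t)"
    unfolding R_def by (simp add: ring_distribs mult_ac)
  finally show ?thesis unfolding b0 by simp
next
  case False
  then have bv: "back t = - v t" by (simp add: back_def)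
  have "dn1 (y t) * (x t - pos_powr q (y t)) * v t \<le> \<bar>dn1 (y t) * (x t - pos_powr q (y t))\<bar> * back t"
  proof -
    have "- (dn1 (y t) * (x t - pos_powr q (y t))) * back t \<le> \<bar>dn1 (y t) * (x t - pos_powr q (y t))\<bar> * back t"
      using back_nonneg by (intro mult_right_mono) auto
    then show ?thesis unfolding bv by simp
  qed
  also have "\<dots> \<le> 1/100 * back t"
    using dn1_small[OF t] dn1_nonneg[of "y t"] back_nonneg
    by (intro mult_right_mono) (auto simp: abs_mult)
  finally show ?thesis unfolding bv by simp
qed

lemma gain_bound:
  assumes var: "18 * gain \<le> integral {a..c} (\<lambda>t. \<bar>v t\<bar>)" and d: "d > 0"
  defines "k \<equiv> q * (q - 1)"
  shows "gain \<le> k / d ^ (b+2) * ((160 * real b * gain)\<^sup>2 * gain) + 2 * k * d ^ b * (4 / d + gain / d\<^sup>2) + gain / 100"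
proof -
  have k: "k > 0" using q_ge by (simp add: k_def)
  have den: "d\<^sup>2 + z\<^sup>2 > 0" for z using d by (simp add: add_pos_nonneg)
  have cd: "continuous_on UNIV (\<lambda>z. 1 / (d\<^sup>2 + z\<^sup>2))"
    using den by (intro continuous_intros) (auto simp: less_imp_neq[symmetric])
  \<comment> \<open>The remainder weight is exact in y, so its integral against v is at most pi / d
    however often the curve passes the cusp.\<close>
  have at: "ac a c (\<lambda>t. arctan (y t / d) / d) (\<lambda>t. 1 / (d\<^sup>2 + (y t)\<^sup>2) * v t)"
  proof (rule ac_compose[OF ac_y _ cd])
    fix z
    have "((\<lambda>z. arctan (z / d) / d) has_real_derivative inverse (1 + (z / d)\<^sup>2) * (1 / d) / d) (at z)"
      using d by (auto intro!: derivative_eq_intros)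
    moreover have "inverse (1 + (z / d)\<^sup>2) * (1 / d) / d = 1 / (d\<^sup>2 + z\<^sup>2)"
    proof -
      have "(1 + (z / d)\<^sup>2) * d * d = d\<^sup>2 + z\<^sup>2" using d by (simp add: power2_eq_square field_simps)
      then show ?thesis by (metis divide_divide_eq_left inverse_eq_divide mult.assoc mult.right_neutral times_divide_eq_right)
    qed
    ultimately show "((\<lambda>z. arctan (z / d) / d) has_real_derivative 1 / (d\<^sup>2 + z\<^sup>2)) (at z)" by simp
  qed
  let ?D = "\<lambda>t. 1 / (d\<^sup>2 + (y t)\<^sup>2)"
  have cD: "continuous_on {a..c} ?D" by (rule cont_comp[OF cd])
  have i1: "(\<lambda>t. defect (x t) (y t) * (v t + back t)) integrable_on {a..c}"
    and i2: "(\<lambda>t. ?D t * (v t + back t)) integrable_on {a..c}"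
    by (intro cont_mult_int cont_defect cD set_integral_add v_int back_int)+
  have "gain \<le> integral {a..c} (\<lambda>t. k / d ^ (b+2) * (defect (x t) (y t) * (v t + back t))
      + 2 * k * d ^ b * (?D t * (v t + back t)) + 1/100 * back t)"
    unfolding gain_def k_def using d
    by (intro integral_le gain_int integrable_add integrable_on_mult_right i1 i2 back_integrable gain_integrand_le)
  also have "\<dots> = k / d ^ (b+2) * integral {a..c} (\<lambda>t. defect (x t) (y t) * (v t + back t))
      + 2 * k * d ^ b * integral {a..c} (\<lambda>t. ?D t * (v t + back t)) + 1/100 * integral {a..c} back"
    by (subst integral_add integral_mult_right | intro integrable_add integrable_on_mult_right i1 i2 back_integrable)+ simp
  also have "\<dots> \<le> k / d ^ (b+2) * ((160 * real b * gain)\<^sup>2 * gain) + 2 * k * d ^ b * (4 / d + gain / d\<^sup>2) + 1/100 * gain"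
  proof (intro add_mono mult_left_mono integral_back_le)
    \<comment> \<open>The constraint equates the defect met going forward with that met going
      backward: a supremum of order \<open>gain\<close> squared times a backward variation of at
      most \<open>gain\<close>.\<close>
    have "integral {a..c} (\<lambda>t. defect (x t) (y t) * (v t + back t)) =
      integral {a..c} (\<lambda>t. defect (x t) (y t) * v t) + integral {a..c} (\<lambda>t. defect (x t) (y t) * back t)"
      unfolding distrib_left by (intro integral_add cont_mult_int cont_defect v_int back_int)
    also have "\<dots> = integral {a..c} (\<lambda>t. defect (x t) (y t) * back t)" by (simp add: defect_0)
    also have "\<dots> \<le> integral {a..c} (\<lambda>t. (160 * real b * gain)\<^sup>2 * back t)"
      by (intro integral_le cont_mult_int cont_defect back_int integrable_on_mult_right back_integrable
          mult_right_mono back_nonneg defect_le[OF var])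
    also have "\<dots> = (160 * real b * gain)\<^sup>2 * integral {a..c} back" by simp
    also have "\<dots> \<le> (160 * real b * gain)\<^sup>2 * gain" by (intro mult_left_mono integral_back_le) auto
    finally show "integral {a..c} (\<lambda>t. defect (x t) (y t) * (v t + back t)) \<le> (160 * real b * gain)\<^sup>2 * gain" .
    have "integral {a..c} (\<lambda>t. ?D t * (v t + back t)) =
      integral {a..c} (\<lambda>t. ?D t * v t) + integral {a..c} (\<lambda>t. ?D t * back t)"
      unfolding distrib_left by (intro integral_add cont_mult_int cD v_int back_int)
    also have "integral {a..c} (\<lambda>t. ?D t * v t) \<le> 4 / d"
    proof -
      have "integral {a..c} (\<lambda>t. ?D t * v t) = (arctan (y c / d) - arctan (y a / d)) / d"
        using ac_diff[OF at, of a c] a_le_c by (simp add: diff_divide_distrib)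
      also have "\<dots> \<le> 4 / d"
        using arctan_ubound[of "y c / d"] arctan_lbound[of "y a / d"] pi_less_4 d
        by (intro divide_right_mono) auto
      finally show ?thesis .
    qed
    also have "integral {a..c} (\<lambda>t. ?D t * back t) \<le> integral {a..c} (\<lambda>t. 1 / d\<^sup>2 * back t)"
      using d by (intro integral_le cont_mult_int cD back_int integrable_on_mult_right back_integrable
          mult_right_mono back_nonneg divide_left_mono) (auto intro!: mult_pos_pos den)
    also have "\<dots> = 1 / d\<^sup>2 * integral {a..c} back" by simp
    also have "\<dots> \<le> 1 / d\<^sup>2 * gain" by (intro mult_left_mono integral_back_le) auto
    finally show "integral {a..c} (\<lambda>t. ?D t * (v t + back t)) \<le> 4 / d + gain / d\<^sup>2" by simp
  qed (use k d in auto)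
  finally show ?thesis by simp
qed

text \<open>The scale \<open>d\<close> is chosen so that the second term of \<open>gain_bound\<close> is \<open>gain / 4\<close>; the first one is
  then \<open>gain\<close> times a multiple of \<open>d ^ (b - 4)\<close>, which is where \<open>b \<ge> 5\<close> enters.\<close>
lemma gain_not_small:
  assumes var: "18 * gain \<le> integral {a..c} (\<lambda>t. \<bar>v t\<bar>)"
  defines "k \<equiv> q * (q - 1)"
  assumes d0: "d0 > 0" "d0 \<le> 1" "8 * k * d0 \<le> 1" "4 * 25600 * 1024 * k ^ 3 * real b ^ 2 * d0 \<le> 1"
    and small: "gain \<le> 32 * k * d0 ^ (b - 1)"
  shows False
proof -
  have k: "k > 0" using q_ge by (simp add: k_def)
  define d where "d = root (b - 1) (gain / (32 * k))"
  have b1: "b - 1 > 0" using b_ge by simp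
  have d: "d > 0" unfolding d_def using gain_pos k b1 by (intro real_root_gt_zero) auto
  have g: "gain = 32 * k * d ^ (b - 1)"
    unfolding d_def using gain_pos k b1 by (subst real_root_pow_pos) auto
  have "d ^ (b - 1) \<le> d0 ^ (b - 1)" using small k unfolding g by simp
  then have dd: "d \<le> d0" using d d0 b1 power_mono_iff[of d d0 "b - 1"] by simp
  then have d1: "d \<le> 1" using d0 by simp
  obtain n where n: "b = n + 5" using b_ge by (metis add.commute le_Suc_ex)
  have g4: "gain = 32 * k * d ^ (n + 4)" using g unfolding n by (simp add: add.commute)
  \<comment> \<open>25600 = 160^2 stems from \<open>defect_le\<close> and 1024 = 32^2 from the
    choice of d. The powers of d match by 2 (b - 1) = (b + 2) + (b - 4), with b - 4 = n + 1.\<close>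
  have T1: "k / d ^ (b+2) * ((160 * real b * gain)\<^sup>2 * gain) \<le> gain / 4"
  proof -
    have "gain\<^sup>2 = 1024 * k\<^sup>2 * (d ^ (n + 4))\<^sup>2" unfolding g4 by (simp add: power_mult_distrib)
    also have "(d ^ (n + 4))\<^sup>2 = d ^ (b + 2) * d ^ (n + 1)"
      unfolding n power_add[symmetric] power_mult[symmetric] by (simp add: mult.commute add.commute)
    finally have "k / d ^ (b+2) * ((160 * real b * gain)\<^sup>2 * gain) =
        (25600 * 1024 * k ^ 3 * real b ^ 2 * d ^ (n + 1)) * gain"
      using d unfolding power_mult_distrib by (simp add: power2_eq_square power3_eq_cube)
    also have "\<dots> \<le> (25600 * 1024 * k ^ 3 * real b ^ 2 * d0) * gain"
    proof (intro mult_right_mono mult_left_mono)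
      have "d ^ (n + 1) \<le> d ^ 1" using d d1 by (intro power_decreasing) auto
      then show "d ^ (n + 1) \<le> d0" using dd by simp
    qed (use k gain_pos in auto)
    also have "\<dots> \<le> (1/4) * gain" using d0 gain_pos by (intro mult_right_mono) auto
    finally show ?thesis by simp
  qed
  have T2: "2 * k * d ^ b * (4 / d) = gain / 4"
    using d unfolding g4 n by (simp add: power_add field_simps power_numeral_reduce)
  have T3: "2 * k * d ^ b * (gain / d\<^sup>2) \<le> gain / 4"
  proof -
    have "2 * k * d ^ b * (gain / d\<^sup>2) = 2 * k * d ^ (n + 3) * gain"
      using d unfolding n by (simp add: power_add power2_eq_square power_numeral_reduce)
    also have "\<dots> \<le> 2 * k * d0 * gain"
    proof (intro mult_right_mono mult_left_mono)
      have "d ^ (n + 3) \<le> d ^ 1" using d d1 by (intro power_decreasing) auto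
      then show "d ^ (n + 3) \<le> d0" using dd by simp
    qed (use k gain_pos in auto)
    also have "\<dots> \<le> (1/4) * gain" using d0 gain_pos by (intro mult_right_mono) auto
    finally show ?thesis by simp
  qed
  note gain_bound[OF var d, folded k_def, unfolded distrib_left[of "2 * k * d ^ b"]]
  also have "k / d ^ (b+2) * ((160 * real b * gain)\<^sup>2 * gain)
      + (2 * k * d ^ b * (4 / d) + 2 * k * d ^ b * (gain / d\<^sup>2)) + gain / 100
    \<le> gain / 4 + (gain / 4 + gain / 4) + gain / 100"
    by (intro add_mono T1 T3 eq_refl[OF T2] order_refl)
  finally have "gain \<le> gain / 4 + (gain / 4 + gain / 4) + gain / 100" .
  then show False using gain_pos by simp
qed

end

section \<open>Choice of the half-length e; minimality for planar data\<close>

context profile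
begin

text \<open>This primitive serves twice: it turns the height condition into \<open>defect_0\<close>,
  and it is the third coordinate of both arcs.\<close>

lemma flat_height_deriv:
  "((\<lambda>z. - (pos_powr (real (2*b+1)) (- z) / real (2*b+1))) has_real_derivative (pos_powr (real b) (- z))\<^sup>2) (at z)"
proof -
  have "((\<lambda>z. pos_powr (real (2*b+1)) (- z)) has_real_derivative
      real (2*b+1) * pos_powr (real (2*b+1) - 1) (- z) * - 1) (at z)"
    using b_ge by (intro DERIV_chain2[OF pos_powr_deriv]) (auto intro!: derivative_eq_intros)
  from DERIV_minus[OF DERIV_cdivide[OF this, of "real (2*b+1)"]]
  have "((\<lambda>z. - (pos_powr (real (2*b+1)) (- z) / real (2*b+1))) has_real_derivative pos_powr (real (2*b+1) - 1) (- z)) (at z)"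
    by (simp add: add_eq_0_iff)
  moreover have "pos_powr (real (2*b+1) - 1) (- z) = (pos_powr (real b) (- z))\<^sup>2"
    using pos_powr_add[of "real b" "real b" "-z"] by (simp add: power2_eq_square)
  ultimately show ?thesis by simp
qed

lemma continuous_flat_density: "continuous_on A (\<lambda>z. (pos_powr (real b) (- z))\<^sup>2)"
proof -
  have "continuous_on A (\<lambda>z. pos_powr (real b) (- z))"
    by (rule continuous_on_compose2[OF continuous_pos_powr[of "real b" UNIV]])
       (use b_ge in \<open>auto intro!: continuous_intros\<close>)
  then show ?thesis by (intro continuous_intros)
qed

lemma pos_powr_le_max: assumes "1 \<le> r" "y \<le> 1" shows "pos_powr r y \<le> max y 0"
proof -
  have "pos_powr r y = pos_powr (r - 1) y * max y 0" using pos_powr_add[of "r - 1" 1 y]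
    by (simp add: pos_powr_def)
  also have "\<dots> \<le> 1 * max y 0" using assms by (intro mult_right_mono pos_powr_le_1) auto
  finally show ?thesis by simp
qed

text \<open>A competitor shorter than 3 e stays in a box of size 4 e, where slope and curvature are
  small. As k <= b^2, the condition 800 b^2 e <= 1 yields 8 k e <= 1/100, the bound required for
  \<open>dn1_small\<close>.\<close>

lemma length_ge:
  defines "k \<equiv> q * (q - 1)"
  assumes d0: "d0 > 0" "d0 \<le> 1" "8 * k * d0 \<le> 1" "4 * 25600 * 1024 * k ^ 3 * real b ^ 2 * d0 \<le> 1"
    and e: "0 < e" "800 * real b ^ 2 * e \<le> 1" "e \<le> 32 * k * d0 ^ (b - 1)"
    and ac: "a \<le> c" "ac a c x u" "ac a c y v"
    and ends: "x a = 0" "y a = - e" "x c = pos_powr q e" "y c = e"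
    and height: "integral {a..c} (\<lambda>t. ((x t)\<^sup>2 - (y t) ^ b)\<^sup>2 * v t) = e ^ (2*b+1) / real (2*b+1)"
  shows "ell e - ell (- e) \<le> integral {a..c} (\<lambda>t. sqrt ((u t)\<^sup>2 + (v t)\<^sup>2))"
proof (rule ccontr)
  let ?S = "\<lambda>t. sqrt ((u t)\<^sup>2 + (v t)\<^sup>2)"
  assume "\<not> ?thesis"
  then have shorter: "integral {a..c} ?S < ell e - ell (- e)" by simp
  have b5: "real b \<ge> 5" using b_ge by simp
  have b2: "real b ^ 2 \<ge> real b" using b5 self_le_power[of "real b" 2] by simp
  have be: "800 * (real b * e) \<le> 1"
    using mult_right_mono[OF b2 less_imp_le[OF e(1)]] e unfolding mult.assoc by linarith
  have e1: "4000 * e \<le> 1" using mult_right_mono[OF b5 less_imp_le[OF e(1)]] be by linarith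
  have k0: "k > 0" using q_ge by (simp add: k_def)
  have kb: "k \<le> real b ^ 2"
    unfolding k_def power2_eq_square using q_ge two_q by (intro mult_mono) auto
  have ke: "800 * k * e \<le> 1"
    using mult_right_mono[OF kb less_imp_le[OF e(1)]] e unfolding mult.assoc by linarith
  have slope_small: "slope z \<le> 1/2" if "z \<le> 4 * e" for z
  proof -
    have "slope z \<le> q * max z 0" unfolding slope_def
      using q_ge that e1 by (intro mult_left_mono pos_powr_le_max) auto
    also have "\<dots> \<le> q * (4 * e)" using that e q_ge by (intro mult_left_mono) auto
    also have "\<dots> = 2 * (real b * e)" using two_q by simp
    finally show ?thesis using be by linarith
  qed
  have L: "ell e - ell (- e) \<le> 3 * e"
  proof -
    have "- e < e" using e by simp
    from MVT2[OF this, of ell speed] ell_deriv obtain z where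
      z: "z < e" "ell e - ell (- e) = (e - - e) * speed z" by blast
    have "(slope z)\<^sup>2 \<le> (1/2)\<^sup>2" using slope_small[of z] slope_nonneg z e by (intro power_mono) auto
    then have "speed z \<le> 3/2" unfolding speed_def by (intro real_le_lsqrt) (auto simp: power2_eq_square)
    then have "(e - - e) * speed z \<le> (e - - e) * (3/2)" using e by (intro mult_left_mono) auto
    then show ?thesis using z by simp
  qed
  have ui: "u absolutely_integrable_on {a..c}" and vi: "v absolutely_integrable_on {a..c}"
    using ac by (auto simp: ac_def)
  have Si: "?S integrable_on {a..c}"
    using set_integrable_hypot[OF ui vi] by (simp add: absolutely_integrable_on_def)
  have x_le: "\<bar>x t\<bar> \<le> 3 * e" if "t \<in> {a..c}" for t
  proof -
    have "\<bar>x t - x a\<bar> \<le> integral {a..c} ?S"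
      using that by (intro ac_dist_le[OF ac(2) Si]) (auto intro: real_le_rsqrt)
    then show ?thesis using ends shorter L by simp
  qed
  have y_le: "\<bar>y t\<bar> \<le> 4 * e" if "t \<in> {a..c}" for t
  proof -
    have "\<bar>y t - y a\<bar> \<le> integral {a..c} ?S"
      using that by (intro ac_dist_le[OF ac(3) Si]) (auto intro: real_le_rsqrt)
    then show ?thesis using ends shorter L by simp
  qed
  have dn1_small: "dn1 (y t) * \<bar>x t - pos_powr q (y t)\<bar> \<le> 1/100" if t: "t \<in> {a..c}" for t
  proof -
    have yt: "y t \<le> 4 * e" using y_le[OF t] by simp
    have "pos_powr q (y t) \<le> max (y t) 0" using q_ge yt e1 by (intro pos_powr_le_max) auto
    then have "pos_powr q (y t) \<le> 4 * e" using yt e(1) by (simp add: max_def split: if_splits)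
    then have "\<bar>x t - pos_powr q (y t)\<bar> \<le> 8 * e"
      using x_le[OF t] e(1) pos_powr_nonneg[of q "y t"] by linarith
    moreover have "dn1 (y t) \<le> k"
    proof -
      have "k * pos_powr (q - 2) (y t) \<le> k * 1"
        using k0 q_ge yt e1 by (intro mult_left_mono pos_powr_le_1) auto
      then show ?thesis using dn1_le[of "y t"] by (simp add: k_def)
    qed
    ultimately have "dn1 (y t) * \<bar>x t - pos_powr q (y t)\<bar> \<le> k * (8 * e)"
      using k0 by (intro mult_mono) auto
    then show ?thesis using ke by (simp add: algebra_simps)
  qed
  have defect_0: "integral {a..c} (\<lambda>t. defect (x t) (y t) * v t) = 0"
  proof -
    have cx: "continuous_on {a..c} x" and cy: "continuous_on {a..c} y" using ac ac_continuous by blast+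
    note F = ac_compose[OF ac(3) flat_height_deriv continuous_flat_density]
    have "integral {a..c} (\<lambda>t. (pos_powr (real b) (- y t))\<^sup>2 * v t) = e ^ (2*b+1) / real (2*b+1)"
      using ac_diff[OF F, of a c] ac(1) ends e pos_powr_of_nat[of e "2*b+1"] by simp
    moreover have i1: "(\<lambda>t. (pos_powr (real b) (- y t))\<^sup>2 * v t) integrable_on {a..c}"
      using ac_integrable(2)[OF F, of a c] by simp
    moreover have i2: "(\<lambda>t. ((x t)\<^sup>2 - (y t) ^ b)\<^sup>2 * v t) integrable_on {a..c}"
      using absolutely_integrable_continuous_mult[OF _ vi, of "\<lambda>t. ((x t)\<^sup>2 - (y t) ^ b)\<^sup>2"]
      by (simp add: absolutely_integrable_on_def cx cy continuous_intros)
    ultimately show ?thesis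
      unfolding defect_def left_diff_distrib by (simp add: integral_diff height)
  qed
  interpret short_curve b q ell a c x y u v
  proof
    show "a \<le> c" "ac a c x u" "ac a c y v" by fact+
    show "\<bar>x t\<bar> \<le> 1" "\<bar>y t\<bar> \<le> 1" "slope (y t) \<le> 1/2" if "t \<in> {a..c}" for t
      using x_le[OF that] y_le[OF that] e1 slope_small[of "y t"] by auto
    show "dn1 (y t) * \<bar>x t - pos_powr q (y t)\<bar> \<le> 1/100" if "t \<in> {a..c}" for t
      using dn1_small[OF that] .
    show "integral {a..c} (\<lambda>t. defect (x t) (y t) * v t) = 0" by fact
    show "integral {a..c} ?S <
      (n1 (y c) * (x c - pos_powr q (y c)) + ell (y c)) - (n1 (y a) * (x a - pos_powr q (y a)) + ell (y a))"
      using shorter ends e by simp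
  qed
  \<comment> \<open>The crude bound: \<open>gain\<close> is at most a hundredth of the length, so at
    most 3 e / 100. This gives both hypotheses of \<open>gain_not_small\<close>, the vertical
    variation being at least 2 e.\<close>
  have "gain \<le> integral {a..c} (\<lambda>t. 1/100 * ?S t)"
    unfolding gain_def
  proof (intro integral_le gain_int integrable_on_mult_right Si)
    fix t assume t: "t \<in> {a..c}"
    have "dn1 (y t) * (x t - pos_powr q (y t)) * v t \<le> \<bar>dn1 (y t) * (x t - pos_powr q (y t)) * v t\<bar>" by simp
    also have "\<dots> = (dn1 (y t) * \<bar>x t - pos_powr q (y t)\<bar>) * \<bar>v t\<bar>"
      using dn1_nonneg[of "y t"] by (simp add: abs_mult)
    also have "\<dots> \<le> 1/100 * ?S t"
      by (intro mult_mono dn1_small[OF t]) (auto intro: real_le_rsqrt)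
    finally show "dn1 (y t) * (x t - pos_powr q (y t)) * v t \<le> 1/100 * ?S t" .
  qed
  then have gain_le: "100 * gain \<le> 3 * e" using shorter L by simp
  have "18 * gain \<le> integral {a..c} (\<lambda>t. \<bar>v t\<bar>)"
  proof -
    have "norm (integral {a..c} v) \<le> integral {a..c} (\<lambda>t. \<bar>v t\<bar>)"
      using vi by (intro integral_norm_bound_integral) (auto simp: absolutely_integrable_on_def)
    moreover have "integral {a..c} v = 2 * e" using ac_diff[OF ac(3), of a c] ac(1) ends by simp
    ultimately show ?thesis using gain_le e by simp
  qed
  moreover have "gain \<le> 32 * k * d0 ^ (b - 1)" using gain_le e gain_pos by simp
  ultimately show False
    using gain_not_small[folded k_def, OF _ d0] by blast
qed

text \<open>\<open>ell\<close> occurs only through a difference, so the property passes from one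
  antiderivative to another.\<close>

definition shortest :: "real \<Rightarrow> bool" where
  "shortest e \<longleftrightarrow> (\<forall>a c x y u v. a \<le> c \<longrightarrow> ac a c x u \<longrightarrow> ac a c y v \<longrightarrow>
      x a = 0 \<longrightarrow> y a = - e \<longrightarrow> x c = pos_powr q e \<longrightarrow> y c = e \<longrightarrow>
      integral {a..c} (\<lambda>t. ((x t)\<^sup>2 - (y t) ^ b)\<^sup>2 * v t) = e ^ (2*b+1) / real (2*b+1) \<longrightarrow>
      ell e - ell (- e) \<le> integral {a..c} (\<lambda>t. sqrt ((u t)\<^sup>2 + (v t)\<^sup>2)))"

lemma shortest_ex: "\<exists>e>0. shortest e"
proof -
  define k where "k = q * (q - 1)"
  have k: "k > 0" using q_ge by (simp add: k_def)
  have b: "real b > 0" using b_ge by simp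
  define d0 where "d0 = min 1 (min (1 / (8 * k)) (1 / (4 * 25600 * 1024 * k ^ 3 * real b ^ 2)))"
  have d0: "d0 > 0" "d0 \<le> 1" using k b by (auto simp: d0_def)
  have d1: "8 * k * d0 \<le> 1"
  proof -
    have "8 * k * d0 \<le> 8 * k * (1 / (8 * k))" using k by (intro mult_left_mono) (auto simp: d0_def)
    then show ?thesis using k by simp
  qed
  have d2: "4 * 25600 * 1024 * k ^ 3 * real b ^ 2 * d0 \<le> 1"
  proof -
    let ?c = "4 * 25600 * 1024 * k ^ 3 * real b ^ 2"
    have c: "?c > 0" using k b by simp
    have "?c * d0 \<le> ?c * (1 / ?c)" using c by (intro mult_left_mono) (auto simp: d0_def)
    also have "\<dots> = 1"
    proof -
      have "z * (1 / z) = 1" if "z > 0" for z :: real using that by simp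
      then show ?thesis using c by blast
    qed
    finally show ?thesis .
  qed
  define e where "e = min (1 / (800 * real b ^ 2)) (32 * k * d0 ^ (b - 1))"
  have e: "e > 0" "e \<le> 32 * k * d0 ^ (b - 1)" using k b d0 by (auto simp: e_def)
  have e2: "800 * real b ^ 2 * e \<le> 1"
  proof -
    have "800 * real b ^ 2 * e \<le> 800 * real b ^ 2 * (1 / (800 * real b ^ 2))"
      using b by (intro mult_left_mono) (auto simp: e_def)
    then show ?thesis using b by simp
  qed
  have "shortest e"
    unfolding shortest_def
    by (intro allI impI length_ge[folded k_def, OF d0 d1 d2 e(1) e2 e(2)]) assumption+
  then show ?thesis using e(1) by blast
qed

end

section \<open>Horizontal curves\<close>

lemma vector_3_eq: "(vector [x, y, z] :: real^3) = x *\<^sub>R axis 1 1 + y *\<^sub>R axis 2 1 + z *\<^sub>R axis 3 1"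
  by (simp add: vec_eq_iff forall_3 axis_def)

lemma inner_vector_3: "(p :: real^3) \<bullet> vector [x, y, z] = p$1 * x + p$2 * y + p$3 * z"
  by (simp add: inner_vec_def sum_3)

lemma scaleR_vector_3: "k *\<^sub>R (vector [x, y, z] :: real^3) = vector [k * x, k * y, k * z]"
  by (simp add: vec_eq_iff forall_3)

lemma add_vector_3: "(vector [x, y, z] :: real^3) + vector [x', y', z'] = vector [x + x', y + y', z + z']"
  by (simp add: vec_eq_iff forall_3)

lemma set_integrable_lborel_absolutely:
  fixes f :: "real \<Rightarrow> real"
  assumes "set_integrable lborel S f" shows "f absolutely_integrable_on S"
  using set_borel_integral_eq_integral(1)[OF assms]
    set_borel_integral_eq_integral(1)[OF set_integrable_abs[OF assms]]
  by (simp add: absolutely_integrable_on_def)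

lemma set_integrable_lborel_Icc_subset:
  fixes f :: "real \<Rightarrow> 'a::{banach, second_countable_topology}"
  assumes "set_integrable lborel {a..c} f" "a \<le> r" "t \<le> c"
  shows "set_integrable lborel {r..t} f"
  using assms by (intro set_integrable_subset[OF assms(1)]) auto

lemma set_lebesgue_integral_component:
  fixes f :: "real \<Rightarrow> real^3"
  assumes "set_integrable lborel S f"
  shows "(LINT s:S|lborel. f s) $ i = integral S (\<lambda>s. f s $ i)"
  using set_borel_integral_eq_integral[OF assms] by simp

lemma ctrl_length_eq:
  assumes "set_integrable lborel {a..c} u1" "set_integrable lborel {a..c} u2"
  shows "ctrl_length u1 u2 a c = integral {a..c} (\<lambda>s. sqrt ((u1 s)\<^sup>2 + (u2 s)\<^sup>2))"
  unfolding ctrl_length_def by (rule set_borel_integral_eq_integral(2)[OF set_integrable_hypot[OF assms]])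

lemma control_vector: "k *\<^sub>R X1 p + l *\<^sub>R X2 b p = vector [k, l, (P b p)\<^sup>2 * l]"
  by (simp add: X1_def X2_def scaleR_vector_3 add_vector_3 mult.commute)

text \<open>Passage from Lebesgue integrals to the gauge-integral predicate \<open>ac\<close>. The
  third coordinate survives only as one integral condition over the whole interval.\<close>

lemma horizontal_ctrl_ac:
  assumes "horizontal_ctrl b \<eta> u1 u2 a c"
  shows "a \<le> c" "ac a c (\<lambda>t. \<eta> t $ 1) u1" "ac a c (\<lambda>t. \<eta> t $ 2) u2"
    and "integral {a..c} (\<lambda>t. ((\<eta> t $ 1)\<^sup>2 - (\<eta> t $ 2) ^ b)\<^sup>2 * u2 t) = \<eta> c $ 3 - \<eta> a $ 3"
    and "ctrl_length u1 u2 a c = integral {a..c} (\<lambda>s. sqrt ((u1 s)\<^sup>2 + (u2 s)\<^sup>2))"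
proof -
  let ?f = "\<lambda>s. u1 s *\<^sub>R X1 (\<eta> s) + u2 s *\<^sub>R X2 b (\<eta> s)"
  have f: "set_integrable lborel {a..c} ?f" and u: "set_integrable lborel {a..c} u1" "set_integrable lborel {a..c} u2"
    and ac: "a \<le> c" and eq: "\<And>t. t \<in> {a..c} \<Longrightarrow> \<eta> t = \<eta> a + (LINT s:{a..t}|lborel. ?f s)"
    using assms unfolding horizontal_ctrl_def by blast+
  have comp: "\<eta> t $ i = \<eta> a $ i + integral {a..t} (\<lambda>s. ?f s $ i)" if t: "t \<in> {a..c}" for t i
  proof -
    have "set_integrable lborel {a..t} ?f" using t by (intro set_integrable_lborel_Icc_subset[OF f]) auto
    then show ?thesis
      by (subst eq[OF t]) (simp only: vector_add_component set_lebesgue_integral_component)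
  qed
  show "a \<le> c" by (rule ac)
  show "ac a c (\<lambda>t. \<eta> t $ 1) u1"
    unfolding ac_def
  proof (intro conjI ballI set_integrable_lborel_absolutely[OF u(1)])
    fix t assume "t \<in> {a..c}"
    from comp[OF this, of 1] show "\<eta> t $ 1 = \<eta> a $ 1 + integral {a..t} u1"
      unfolding control_vector vector_3 .
  qed
  show "ac a c (\<lambda>t. \<eta> t $ 2) u2"
    unfolding ac_def
  proof (intro conjI ballI set_integrable_lborel_absolutely[OF u(2)])
    fix t assume "t \<in> {a..c}"
    from comp[OF this, of 2] show "\<eta> t $ 2 = \<eta> a $ 2 + integral {a..t} u2"
      unfolding control_vector vector_3 .
  qed
  show "integral {a..c} (\<lambda>t. ((\<eta> t $ 1)\<^sup>2 - (\<eta> t $ 2) ^ b)\<^sup>2 * u2 t) = \<eta> c $ 3 - \<eta> a $ 3"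
    using comp[of c 3] ac unfolding control_vector vector_3 P_def by simp
  show "ctrl_length u1 u2 a c = integral {a..c} (\<lambda>s. sqrt ((u1 s)\<^sup>2 + (u2 s)\<^sup>2))"
    by (rule ctrl_length_eq[OF u])
qed

lemma vector_3_has_vector_derivative:
  assumes "(X has_real_derivative X') (at t)" "(Y has_real_derivative Y') (at t)" "(Z has_real_derivative Z') (at t)"
  shows "((\<lambda>t. vector [X t, Y t, Z t] :: real^3) has_vector_derivative vector [X', Y', Z']) (at t)"
  unfolding vector_3_eq using assms by (auto intro!: derivative_eq_intros)

lemma continuous_on_vector_3:
  assumes "continuous_on A X" "continuous_on A Y" "continuous_on A Z"
  shows "continuous_on A (\<lambda>t. vector [X t, Y t, Z t] :: real^3)"
  unfolding vector_3_eq by (intro continuous_intros assms)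

lemma integral_of_continuous_derivative:
  fixes F :: "real \<Rightarrow> real^3"
  assumes "\<And>t. (F has_vector_derivative f t) (at t)" "continuous_on UNIV f"
  shows "set_integrable lborel {a..c} f" "a \<le> t \<Longrightarrow> F t = F a + (LINT s:{a..t}|lborel. f s)"
proof -
  have 1: "set_integrable lborel {a..c} f" for c
    by (intro borel_integrable_atLeastAtMost' continuous_on_subset[OF assms(2)]) auto
  then show "set_integrable lborel {a..c} f" .
  assume "a \<le> t"
  then have "(f has_integral (F t - F a)) {a..t}"
    by (rule fundamental_theorem_of_calculus) (rule has_vector_derivative_at_within[OF assms(1)])
  then show "F t = F a + (LINT s:{a..t}|lborel. f s)"
    using set_borel_integral_eq_integral(2)[OF 1] by (simp add: integral_unique)
qed

lemma horizontal_ctrl_smooth: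
  assumes d: "\<And>t. (X has_real_derivative X' t) (at t)" "\<And>t. (Y has_real_derivative Y' t) (at t)"
      "\<And>t. (Z has_real_derivative ((X t)\<^sup>2 - Y t ^ b)\<^sup>2 * Y' t) (at t)"
    and c: "continuous_on UNIV X'" "continuous_on UNIV Y'" and "a \<le> c"
    and \<eta>: "\<eta> = (\<lambda>t. vector [X t, Y t, Z t])"
  shows "horizontal_ctrl b \<eta> X' Y' a c"
proof -
  have f: "(\<lambda>s. X' s *\<^sub>R X1 (\<eta> s) + Y' s *\<^sub>R X2 b (\<eta> s)) = (\<lambda>s. vector [X' s, Y' s, ((X s)\<^sup>2 - Y s ^ b)\<^sup>2 * Y' s])"
    by (simp add: control_vector \<eta> P_def)
  have cXY: "continuous_on UNIV X" "continuous_on UNIV Y"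
    using d(1,2) by (meson DERIV_isCont continuous_at_imp_continuous_on)+
  have dv: "(\<eta> has_vector_derivative vector [X' s, Y' s, ((X s)\<^sup>2 - Y s ^ b)\<^sup>2 * Y' s]) (at s)" for s
    unfolding \<eta> by (rule vector_3_has_vector_derivative[OF d])
  have cf: "continuous_on UNIV (\<lambda>s. vector [X' s, Y' s, ((X s)\<^sup>2 - Y s ^ b)\<^sup>2 * Y' s] :: real^3)"
    by (intro continuous_on_vector_3 continuous_intros c cXY)
  show ?thesis unfolding horizontal_ctrl_def f
    using integral_of_continuous_derivative[OF dv cf] \<open>a \<le> c\<close>
    by (auto intro!: borel_integrable_atLeastAtMost' continuous_on_subset[OF c(1)] continuous_on_subset[OF c(2)])
qed

section \<open>Gradients entering the adjoint equation\<close>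

lemma P_has_derivative:
  "(P b has_derivative (\<lambda>h. 2 * x$1 * h$1 - real b * (x$2) ^ (b - 1) * h$2)) (at x)"
proof -
  have n: "((\<lambda>y :: real^3. y $ i) has_derivative (\<lambda>h. h $ i)) (at x)" for i
    by (rule bounded_linear.has_derivative[OF bounded_linear_vec_nth has_derivative_ident])
  show ?thesis unfolding P_def
    by (rule derivative_eq_intros n refl)+ (simp add: fun_eq_iff algebra_simps)
qed

lemma grad_h_X1: "grad_h X1 l x = 0"
  by (simp add: grad_h_def X1_def vec_eq_iff)

text \<open>The product of \<open>x$1\<close> and \<open>P b x\<close> is kept as a block because it
  vanishes along both arcs.\<close>

lemma grad_h_X2:
  "grad_h (X2 b) l x = vector [4 * (x$1 * P b x) * l$3, - (2 * real b * (x$2) ^ (b - 1) * P b x * l$3), 0]"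
proof -
  have eq: "(\<lambda>y. l \<bullet> X2 b y) = (\<lambda>y. l$2 + (P b y)\<^sup>2 * l$3)"
    by (simp add: X2_def inner_vector_3 mult.commute)
  have "((\<lambda>y. l$2 + (P b y)\<^sup>2 * l$3) has_derivative
      (\<lambda>h. 2 * P b x * (2 * x$1 * h$1 - real b * (x$2) ^ (b - 1) * h$2) * l$3)) (at x)"
    by (rule derivative_eq_intros P_has_derivative refl)+ (simp add: fun_eq_iff algebra_simps)
  from frechet_derivative_at[OF this, folded eq, symmetric]
  show ?thesis unfolding grad_h_def
    by (simp add: vec_eq_iff forall_3 axis_def)
qed

section \<open>The two arcs\<close>

lemma exists_antiderivative:
  fixes f :: "real \<Rightarrow> real"
  assumes "continuous_on UNIV f"
  shows "\<exists>F. \<forall>y. (F has_real_derivative f y) (at y)"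
  using einterval_antiderivative[of "-\<infinity>" "\<infinity>" f] assms
  by (simp add: continuous_on_eq_continuous_at has_real_derivative_iff_has_vector_derivative)

context profile
begin

lemma ell_increasing: assumes "s \<le> t" shows "t - s \<le> ell t - ell s"
proof (cases "s = t")
  case False
  then have "s < t" using assms by simp
  from MVT2[OF this, of ell speed] ell_deriv obtain z where "ell t - ell s = (t - s) * speed z" by blast
  then show ?thesis using mult_left_mono[OF speed_ge[of z], of "t - s"] assms by simp
qed simp

lemma ell_less: "s < t \<Longrightarrow> ell s < ell t"
  using ell_increasing[of s t] by simp

lemma continuous_ell: "continuous_on A ell"
  using ell_deriv by (meson DERIV_isCont continuous_at_imp_continuous_on)

text \<open>Speed at least 1 makes \<open>ell\<close> a bijection of the line; \<open>r\<close>
  converts arc length into the height y. Working on the whole line avoids one-sided derivatives at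
  the ends.\<close>

lemma ell_inverse:
  obtains r where "\<And>z. ell (r z) = z" "\<And>t. r (ell t) = t"
    "\<And>z. (r has_real_derivative 1 / speed (r z)) (at z)"
proof -
  have inj: "inj ell" by (rule linorder_injI) (use ell_less in \<open>metis less_irrefl\<close>)
  have surj: "\<exists>y. ell y = z" for z
  proof (cases "ell 0 \<le> z")
    case True
    then have "z \<le> ell (z - ell 0)" using ell_increasing[of 0 "z - ell 0"] by simp
    then show ?thesis using IVT'[of ell 0 z "z - ell 0"] True continuous_ell by auto
  next
    case False
    then have "ell (z - ell 0) \<le> z" using ell_increasing[of "z - ell 0" 0] by simp
    then show ?thesis using IVT'[of ell "z - ell 0" z 0] False continuous_ell by auto
  qed
  define r where "r = inv ell"
  have r: "ell (r z) = z" "r (ell t) = t" for z t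
    unfolding r_def using surj inj by (metis f_inv_into_f rangeI, simp)
  have "(r has_real_derivative 1 / speed (r z)) (at z)" for z
  proof -
    have "(r has_derivative (*) (1 / speed (r z))) (at (ell (r z)))"
    proof (rule has_derivative_inverse_strong[OF open_UNIV UNIV_I continuous_ell r(2)])
      show "(ell has_derivative (*) (speed (r z))) (at (r z))"
        using ell_deriv by (simp add: has_field_derivative_def)
      show "(*) (speed (r z)) \<circ> (*) (1 / speed (r z)) = id"
        using speed_pos[of "r z"] by (auto simp: fun_eq_iff)
    qed
    then show ?thesis unfolding has_field_derivative_def r(1) .
  qed
  with r that show thesis by blast
qed

definition gamma_sgn :: "real \<Rightarrow> real \<Rightarrow> real^3" where
  "gamma_sgn sg t = vector [sg * pos_powr q t, t, - (pos_powr (real (2*b+1)) (- t) / real (2*b+1))]"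

lemma gamma_eq: "gamma b = gamma_sgn 1" and gamma_bar_eq: "gamma_bar b = gamma_sgn (-1)"
proof -
  have neg: "- (pos_powr (real (2*b+1)) (- t) / real (2*b+1)) = t ^ (2*b+1) / real (2*b+1)" if "t < 0" for t
    using that pos_powr_of_nat[of "-t" "2*b+1"] power_minus_odd[of "2*b+1" t] by simp
  show "gamma b = gamma_sgn 1" "gamma_bar b = gamma_sgn (-1)"
    unfolding gamma_def gamma_bar_def gamma_sgn_def fun_eq_iff
    using neg by (auto simp: pos_powr_pos q_def)
qed

lemma gamma_sgn_defect:
  assumes "sg\<^sup>2 = 1" shows "(sg * pos_powr q t)\<^sup>2 - t ^ b = pos_powr (real b) (- t)"
proof -
  have "(sg * pos_powr q t)\<^sup>2 = pos_powr q t * pos_powr q t"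
    by (simp only: power_mult_distrib assms) (simp add: power2_eq_square)
  also have "\<dots> = pos_powr (real b) t" using pos_powr_add[of q q t] two_q by simp
  finally show ?thesis by (simp add: odd_power_eq_pos_powr[OF b_odd])
qed

lemma pos_powr_q_deriv: "(pos_powr q has_real_derivative slope t) (at t)"
  using pos_powr_deriv[of q t] q_ge by (simp add: slope_def)

text \<open>The parameter change is left open: the identity serves to compute the length, the
  inverse of \<open>ell\<close> to obtain unit speed.\<close>

lemma horizontal_arc:
  assumes sg: "sg\<^sup>2 = 1" and "a \<le> c" and r: "\<And>z. (r has_real_derivative r' z) (at z)" "continuous_on UNIV r'"
  shows "horizontal_ctrl b (\<lambda>z. gamma_sgn sg (r z)) (\<lambda>z. sg * (slope (r z) * r' z)) r' a c"
proof (rule horizontal_ctrl_smooth[where X="\<lambda>z. sg * pos_powr q (r z)" and Y=r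
      and Z="\<lambda>z. - (pos_powr (real (2*b+1)) (- r z) / real (2*b+1))"])
  fix z
  show "((\<lambda>z. sg * pos_powr q (r z)) has_real_derivative sg * (slope (r z) * r' z)) (at z)"
    by (intro DERIV_cmult DERIV_chain2[OF pos_powr_q_deriv r(1)])
  show "(r has_real_derivative r' z) (at z)" by (rule r)
  show "((\<lambda>z. - (pos_powr (real (2*b+1)) (- r z) / real (2*b+1))) has_real_derivative
      ((sg * pos_powr q (r z))\<^sup>2 - r z ^ b)\<^sup>2 * r' z) (at z)"
    unfolding gamma_sgn_defect[OF sg] by (rule DERIV_chain2[OF flat_height_deriv r(1)])
  have "continuous_on UNIV r" using r(1) by (meson DERIV_isCont continuous_at_imp_continuous_on)
  then have "continuous_on UNIV (\<lambda>z. slope (r z))"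
    by (rule continuous_on_compose2[OF continuous_slope]) auto
  then show "continuous_on UNIV (\<lambda>z. sg * (slope (r z) * r' z))" by (intro continuous_intros r)
  show "continuous_on UNIV r'" "a \<le> c" by fact+
  show "(\<lambda>z. gamma_sgn sg (r z)) = (\<lambda>z. vector [sg * pos_powr q (r z), r z, - (pos_powr (real (2*b+1)) (- r z) / real (2*b+1))])"
    by (simp add: gamma_sgn_def)
qed

text \<open>On the arc itself the curvature term vanishes, so the calibration is exact and bounds
  the length of every control from below. This replaces a proof that the control is unique almost
  everywhere.\<close>

lemma L_SR_arc:
  assumes sg: "sg\<^sup>2 = 1" and at: "a \<le> t"
  shows "L_SR b (gamma_sgn sg) a t = ell t - ell a"
  unfolding L_SR_def
proof (rule cInf_eq_minimum)
  have "horizontal_ctrl b (\<lambda>z. gamma_sgn sg z) (\<lambda>z. sg * (slope z * 1)) (\<lambda>z. 1) a t"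
    by (rule horizontal_arc[OF sg at]) auto
  then have h: "horizontal_ctrl b (gamma_sgn sg) (\<lambda>z. sg * (slope z * 1)) (\<lambda>z. 1) a t" by simp
  have "ctrl_length (\<lambda>z. sg * (slope z * 1)) (\<lambda>z. 1) a t = integral {a..t} speed"
    unfolding horizontal_ctrl_ac(5)[OF h]
    by (simp add: speed_def[abs_def] power_mult_distrib sg add.commute)
  also have "\<dots> = ell t - ell a"
    by (intro integral_unique fundamental_theorem_of_calculus at)
      (simp add: has_field_derivative_at_within ell_deriv flip: has_real_derivative_iff_has_vector_derivative)
  finally show "ell t - ell a \<in> {ctrl_length u1 u2 a t |u1 u2. horizontal_ctrl b (gamma_sgn sg) u1 u2 a t}"
    using h by force
next
  fix l assume "l \<in> {ctrl_length u1 u2 a t |u1 u2. horizontal_ctrl b (gamma_sgn sg) u1 u2 a t}"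
  then obtain u1 u2 where l: "l = ctrl_length u1 u2 a t" and h: "horizontal_ctrl b (gamma_sgn sg) u1 u2 a t" by blast
  note H = horizontal_ctrl_ac[OF h]
  have sgsg: "sg * (sg * z) = z" for z using sg by (simp add: power2_eq_square flip: mult.assoc)
  have x: "ac a t (pos_powr q) (\<lambda>s. sg * u1 s)" using ac_cmult[OF H(2), of sg] by (simp add: gamma_sgn_def sgsg)
  have y: "ac a t (\<lambda>s. s) u2" using H(3) by (simp add: gamma_sgn_def)
  have "ell t - ell a = integral {a..t} (\<lambda>s. n1 s * (sg * u1 s) + 1 / speed s * u2 s)"
    using calibration[OF x y at] by simp
  also have "\<dots> \<le> integral {a..t} (\<lambda>s. sqrt ((u1 s)\<^sup>2 + (u2 s)\<^sup>2))"
  proof (rule integral_le)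
    have i: "(\<lambda>s. sg * u1 s) absolutely_integrable_on {a..t}" "u2 absolutely_integrable_on {a..t}"
      using x y by (auto simp: ac_def)
    then show "(\<lambda>s. n1 s * (sg * u1 s) + 1 / speed s * u2 s) integrable_on {a..t}"
      using absolutely_integrable_continuous_mult[OF continuous_n1 i(1)]
        absolutely_integrable_continuous_mult[OF continuous_inv_speed i(2)]
      by (intro integrable_add) (auto simp: absolutely_integrable_on_def)
    have "u1 absolutely_integrable_on {a..t}" using H(2) by (auto simp: ac_def)
    from set_integrable_hypot[OF this i(2)]
    show "(\<lambda>s. sqrt ((u1 s)\<^sup>2 + (u2 s)\<^sup>2)) integrable_on {a..t}"
      by (simp add: absolutely_integrable_on_def)
    fix s
    have "1 / speed s * u2 s \<le> 1 / speed s * \<bar>u2 s\<bar>" using speed_pos[of s] by (intro mult_left_mono) auto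
    then show "n1 s * (sg * u1 s) + 1 / speed s * u2 s \<le> sqrt ((u1 s)\<^sup>2 + (u2 s)\<^sup>2)"
      using calibration_le[of s "sg * u1 s" "u2 s"] by (simp add: power_mult_distrib sg)
  qed
  finally show "ell t - ell a \<le> l" unfolding l H(5) .
qed

end

section \<open>Minimality and strict abnormality of the unit-speed arcs\<close>

locale unit_speed_arc = profile +
  fixes e sg :: real and r :: "real \<Rightarrow> real"
  assumes e_pos: "e > 0" and sg: "sg\<^sup>2 = 1" and ell_start: "ell (- e) = 0"
    and r_ell: "\<And>t. r (ell t) = t"
    and r_deriv: "\<And>z. (r has_real_derivative 1 / speed (r z)) (at z)"
    and shortest: "shortest e"
begin

definition "curve z = gamma_sgn sg (r z)"

lemma sgsg: "sg * (sg * z) = z"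
  using sg by (simp add: power2_eq_square flip: mult.assoc)

lemma continuous_r: "continuous_on A r"
  using r_deriv by (meson DERIV_isCont continuous_at_imp_continuous_on)

lemma continuous_r': "continuous_on A (\<lambda>z. 1 / speed (r z))"
  by (rule continuous_on_compose2[OF continuous_inv_speed continuous_r]) auto

lemma ends: "ell e > 0" "r 0 = - e" "r (ell e) = e" "curve 0 = gamma_sgn sg (- e)" "curve (ell e) = gamma_sgn sg e"
  using ell_less[of "- e" e] e_pos ell_start r_ell[of "- e"] r_ell[of e] by (auto simp: curve_def)

lemma curve_nth: "curve z $ 1 = sg * pos_powr q (r z)" "curve z $ 2 = r z"
  by (simp_all add: curve_def gamma_sgn_def)

lemma curve_P: "P b (curve z) = pos_powr (real b) (- r z)"
  using gamma_sgn_defect[OF sg] by (simp add: P_def curve_nth)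

lemma curve_singular: "curve z $ 1 * P b (curve z) = 0"
  using pos_powr_mult_minus[of q "r z"] by (simp add: curve_nth curve_P)

lemma curve_horizontal:
  "0 \<le> c \<Longrightarrow> horizontal_ctrl b curve (\<lambda>z. sg * (slope (r z) * (1 / speed (r z)))) (\<lambda>z. 1 / speed (r z)) 0 c"
  using horizontal_arc[OF sg _ r_deriv continuous_r', of 0 c] by (simp add: curve_def[abs_def])

lemma curve_arclength:
  "(sg * (slope (r z) * (1 / speed (r z))))\<^sup>2 + (1 / speed (r z))\<^sup>2 = 1"
  using unit_normal[of "r z"] by (simp add: power_mult_distrib sg n1_def power_divide)

text \<open>\<open>P\<close> is even in the first coordinate, so multiplying that coordinate by
  \<open>sg\<close> carries competitors of either arc to competitors of the one in
  \<open>shortest\<close>.\<close>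

lemma length_ge_ell:
  assumes h: "horizontal_ctrl b \<eta> u1 u2 a c" and "\<eta> a = gamma_sgn sg (- e)" "\<eta> c = gamma_sgn sg e"
  shows "ell e \<le> ctrl_length u1 u2 a c"
proof -
  note H = horizontal_ctrl_ac[OF h]
  have "integral {a..c} (\<lambda>t. ((sg * \<eta> t $ 1)\<^sup>2 - (\<eta> t $ 2) ^ b)\<^sup>2 * u2 t) = e ^ (2*b+1) / real (2*b+1)"
    using H(4) assms e_pos pos_powr_of_nat[of e "2*b+1"] by (simp add: power_mult_distrib sg gamma_sgn_def)
  moreover have "sg * \<eta> a $ 1 = 0" "\<eta> a $ 2 = - e" "sg * \<eta> c $ 1 = pos_powr q e" "\<eta> c $ 2 = e"
    using assms e_pos by (simp_all add: gamma_sgn_def sgsg)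
  ultimately have "ell e - ell (- e) \<le> integral {a..c} (\<lambda>t. sqrt ((sg * u1 t)\<^sup>2 + (u2 t)\<^sup>2))"
    using shortest[unfolded shortest_def, rule_format, OF H(1) ac_cmult[OF H(2), of sg] H(3)] by blast
  then show ?thesis by (simp add: H(5) power_mult_distrib sg ell_start)
qed

lemma ctrl_length_curve:
  "ctrl_length (\<lambda>z. sg * (slope (r z) * (1 / speed (r z)))) (\<lambda>z. 1 / speed (r z)) 0 (ell e) = ell e"
  unfolding horizontal_ctrl_ac(5)[OF curve_horizontal[OF less_imp_le[OF ends(1)]]] curve_arclength
  using ends(1) by simp

lemma d_SR_curve: "d_SR b (curve 0) (curve (ell e)) = ell e"
  unfolding d_SR_def
proof (rule cInf_eq_minimum)
  show "ell e \<in> {ctrl_length u1 u2 a c | \<eta> u1 u2 a c.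
      horizontal_ctrl b \<eta> u1 u2 a c \<and> \<eta> a = curve 0 \<and> \<eta> c = curve (ell e)}"
    using curve_horizontal[OF less_imp_le[OF ends(1)]] ctrl_length_curve by force
qed (use length_ge_ell ends in auto)

lemma L_SR_curve: "L_SR b curve 0 (ell e) = ell e"
  unfolding L_SR_def
proof (rule cInf_eq_minimum)
  show "ell e \<in> {ctrl_length u1 u2 0 (ell e) | u1 u2. horizontal_ctrl b curve u1 u2 0 (ell e)}"
    using curve_horizontal[OF less_imp_le[OF ends(1)]] ctrl_length_curve by force
qed (use length_ge_ell ends in auto)

lemma curve_minimizing: "minimizing_geodesic b curve 0 (ell e)"
  unfolding minimizing_geodesic_def arclength_ctrl_def L_SR_curve d_SR_curve
  using curve_horizontal[OF less_imp_le[OF ends(1)]] curve_arclength by force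

text \<open>Annihilating both fields forces a covector proportional to (0, -P^2, 1). By
  \<open>curve_singular\<close> its first component may stay 0, and the same identity removes the
  first-coordinate term from the derivative of -P^2, leaving the second adjoint equation.\<close>

lemma curve_abnormal: "abnormal_extremal b curve 0 (ell e)"
proof -
  define p :: "real \<Rightarrow> real^3" where "p = (\<lambda>z. vector [0, - ((pos_powr (real b) (- r z))\<^sup>2), 1])"
  let ?u1 = "\<lambda>z. sg * (slope (r z) * (1 / speed (r z)))" and ?u2 = "\<lambda>z. 1 / speed (r z)"
  define f :: "real \<Rightarrow> real^3" where
    "f = (\<lambda>z. vector [0, ?u2 z * (2 * real b * (r z) ^ (b - 1) * pos_powr (real b) (- r z)), 0])"
  have adj: "?u1 s *\<^sub>R grad_h X1 (p s) (curve s) + ?u2 s *\<^sub>R grad_h (X2 b) (p s) (curve s) = - f s" for s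
    unfolding grad_h_X1 grad_h_X2 curve_singular
    by (simp add: curve_nth curve_P p_def f_def scaleR_vector_3 vec_eq_iff forall_3)
  have cp: "continuous_on UNIV (\<lambda>z. pos_powr (real b) (- r z))"
    by (rule continuous_on_compose2[OF continuous_pos_powr[of "real b" UNIV]])
       (use b_ge in \<open>auto intro!: continuous_intros continuous_r\<close>)
  have cf: "continuous_on UNIV f"
    unfolding f_def by (intro continuous_on_vector_3 continuous_intros continuous_r continuous_r' cp)
  have dp: "(p has_vector_derivative f z) (at z)" for z
    unfolding p_def f_def
  proof (rule vector_3_has_vector_derivative)
    have 1: "((\<lambda>z. pos_powr (real b) (- r z)) has_real_derivative
        real b * pos_powr (real b - 1) (- r z) * (- ?u2 z)) (at z)"
      using b_ge by (intro DERIV_chain2[OF pos_powr_deriv] DERIV_minus r_deriv) auto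
    have 2: "pos_powr (real b - 1) (- r z) * pos_powr (real b) (- r z) = (r z) ^ (b - 1) * pos_powr (real b) (- r z)"
    proof (cases "r z < 0")
      case True
      have "pos_powr (real b - 1) (- r z) = (- r z) ^ (b - 1)"
        using True b_ge pos_powr_of_nat[of "- r z" "b - 1"] by (simp add: of_nat_diff)
      also have "\<dots> = (r z) ^ (b - 1)" using b_odd by (intro power_minus_even) auto
      finally show ?thesis by simp
    qed simp
    have "((\<lambda>z. - ((pos_powr (real b) (- r z))\<^sup>2)) has_real_derivative
        - (2 * pos_powr (real b) (- r z) * (real b * pos_powr (real b - 1) (- r z) * (- ?u2 z)))) (at z)"
      using DERIV_minus[OF DERIV_power[OF 1, of 2]] by (simp add: mult_ac)
    moreover have "- (2 * pos_powr (real b) (- r z) * (real b * pos_powr (real b - 1) (- r z) * (- ?u2 z)))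
      = ?u2 z * (2 * real b * (r z) ^ (b - 1) * pos_powr (real b) (- r z))"
    proof -
      have "- (2 * A * (k * B * (- w))) = w * (2 * k * (B * A))" for A B k w :: real by (simp add: mult_ac)
      then show ?thesis unfolding mult.assoc[of "2 * real b"] 2[symmetric] .
    qed
    ultimately show "((\<lambda>z. - ((pos_powr (real b) (- r z))\<^sup>2)) has_real_derivative
        ?u2 z * (2 * real b * (r z) ^ (b - 1) * pos_powr (real b) (- r z))) (at z)"
      by (rule DERIV_cong)
  qed auto
  have "adjoint_eq b curve ?u1 ?u2 p 0 (ell e)"
    unfolding adjoint_eq_def adj
    using integral_of_continuous_derivative[OF dp cf]
    by (auto simp: set_integrable_def set_lebesgue_integral_def)
  moreover have "p t \<noteq> 0 \<and> p t \<bullet> X1 (curve t) = 0 \<and> p t \<bullet> X2 b (curve t) = 0" for t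
    unfolding X1_def X2_def inner_vector_3 curve_P by (simp add: p_def vec_eq_iff forall_3)
  ultimately show ?thesis
    unfolding abnormal_extremal_def using curve_horizontal[OF less_imp_le[OF ends(1)]] by blast
qed

text \<open>Since \<open>x\<^sub>1 P\<close> vanishes along the curve, a normal covector has constant first component, which
  would make \<open>x\<^sub>1\<close> an affine function of arc length.\<close>
lemma curve_not_normal: "\<not> normal_extremal b curve 0 (ell e)"
proof
  assume "normal_extremal b curve 0 (ell e)"
  then obtain u1 u2 p where h: "horizontal_ctrl b curve u1 u2 0 (ell e)"
    and adj: "adjoint_eq b curve u1 u2 p 0 (ell e)"
    and n: "AE t in lborel. t \<in> {0..ell e} \<longrightarrow> u1 t = p t \<bullet> X1 (curve t) \<and> u2 t = p t \<bullet> X2 b (curve t)"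
    unfolding normal_extremal_def by blast
  let ?g = "\<lambda>s. u1 s *\<^sub>R grad_h X1 (p s) (curve s) + u2 s *\<^sub>R grad_h (X2 b) (p s) (curve s)"
  have gi: "set_integrable lborel {0..ell e} ?g"
    and p: "\<And>t. t \<in> {0..ell e} \<Longrightarrow> p t = p 0 - (LINT s:{0..t}|lborel. ?g s)"
    using adj unfolding adjoint_eq_def by blast+
  have p1: "p t $ 1 = p 0 $ 1" if t: "t \<in> {0..ell e}" for t
  proof -
    have "set_integrable lborel {0..t} ?g" using t by (intro set_integrable_lborel_Icc_subset[OF gi]) auto
    then have "(LINT s:{0..t}|lborel. ?g s) $ 1 = integral {0..t} (\<lambda>s. ?g s $ 1)"
      by (rule set_lebesgue_integral_component)
    also have "\<dots> = 0" unfolding grad_h_X1 grad_h_X2 curve_singular by simp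
    finally show ?thesis by (subst p[OF t]) simp
  qed
  have u1: "AE t in lborel. t \<in> {0..ell e} \<longrightarrow> u1 t = p 0 $ 1"
    using n
  proof eventually_elim
    case (elim t)
    show ?case
    proof
      assume t: "t \<in> {0..ell e}"
      then have "u1 t = p t $ 1" using elim by (simp add: X1_def inner_vector_3)
      then show "u1 t = p 0 $ 1" using p1[OF t] by (rule trans)
    qed
  qed
  have u1i: "set_integrable lborel {0..ell e} u1" using h unfolding horizontal_ctrl_def by blast
  have x: "curve t $ 1 = p 0 $ 1 * t" if t: "t \<in> {0..ell e}" for t
  proof -
    have i: "set_integrable lborel {0..t} u1" using t by (intro set_integrable_lborel_Icc_subset[OF u1i]) auto
    have "curve t $ 1 = curve 0 $ 1 + integral {0..t} u1"
      using t by (intro ac_eq[OF horizontal_ctrl_ac(2)[OF h]]) auto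
    also have "integral {0..t} u1 = (LINT s:{0..t}|lborel. u1 s)"
      by (rule set_borel_integral_eq_integral(2)[OF i, symmetric])
    also have "\<dots> = (LINT s:{0..t}|lborel. p 0 $ 1)"
      unfolding set_lebesgue_integral_def
    proof (rule integral_cong_AE)
      show "(\<lambda>s. indicator {0..t} s *\<^sub>R u1 s) \<in> borel_measurable lborel"
        using i unfolding set_integrable_def by auto
      show "AE s in lborel. indicator {0..t} s *\<^sub>R u1 s = indicator {0..t} s *\<^sub>R p 0 $ 1"
        using u1 by eventually_elim (use t in \<open>auto simp: indicator_def\<close>)
    qed simp
    also have "\<dots> = p 0 $ 1 * t"
      using t by (simp add: set_borel_integral_eq_integral(2) borel_integrable_atLeastAtMost')
    also have "curve 0 $ 1 = 0" using e_pos by (simp add: ends gamma_sgn_def)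
    finally show ?thesis by simp
  qed
  \<comment> \<open>The cusp is reached at the positive time \<open>ell 0\<close>, where the first
    coordinate is 0; so the constant vanishes, although the first coordinate is nonzero at the
    end.\<close>
  have l0: "0 < ell 0" "ell 0 < ell e" using ell_less[of "- e" 0] ell_less[of 0 e] e_pos ell_start by auto
  have "curve (ell 0) $ 1 = 0" by (simp add: curve_nth r_ell)
  then have "p 0 $ 1 = 0" using x[of "ell 0"] l0 by simp
  then have "curve (ell e) $ 1 = 0" using x[of "ell e"] l0 by simp
  then show False using sg e_pos by (auto simp: curve_nth r_ell pos_powr_pos)
qed

lemma curve_strictly_abnormal: "strictly_abnormal b curve 0 (ell e)"
  using curve_abnormal curve_not_normal by (simp add: strictly_abnormal_def)

end

theorem theorem1p2:
  fixes b :: nat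
  assumes "odd b" and "b \<ge> 5"
  shows "\<exists>s \<epsilon>. s > 0 \<and> \<epsilon> > 0 \<and>
    (\<exists>\<eta> \<eta>' :: real \<Rightarrow> real^3.
       (\<forall>t\<in>{-s..\<epsilon>}. \<eta> (L_SR b (gamma b) (-s) t) = gamma b t
                      \<and> \<eta>' (L_SR b (gamma_bar b) (-s) t) = gamma_bar b t)
     \<and> minimizing_geodesic b \<eta> 0 (L_SR b (gamma b) (-s) \<epsilon>)
     \<and> strictly_abnormal b \<eta> 0 (L_SR b (gamma b) (-s) \<epsilon>)
     \<and> minimizing_geodesic b \<eta>' 0 (L_SR b (gamma_bar b) (-s) \<epsilon>)
     \<and> strictly_abnormal b \<eta>' 0 (L_SR b (gamma_bar b) (-s) \<epsilon>)
     \<and> (\<forall>t\<in>{0..L_SR b (gamma b) (-s) 0}. \<eta> t = \<eta>' t)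
     \<and> (\<forall>\<tau>\<in>{L_SR b (gamma b) (-s) 0<..L_SR b (gamma b) (-s) \<epsilon>}.
          \<exists>t\<in>{0..\<tau>}. \<eta> t \<noteq> \<eta>' t))"
proof -
  define q where "q = real b / 2"
  have q: "q \<ge> 5/2" using assms by (simp add: q_def)
  have "continuous_on UNIV (\<lambda>y. sqrt (1 + (q * pos_powr (q - 1) y)\<^sup>2))"
    using q by (intro continuous_intros continuous_pos_powr) auto
  then obtain F where F: "\<And>y. (F has_real_derivative sqrt (1 + (q * pos_powr (q - 1) y)\<^sup>2)) (at y)"
    using exists_antiderivative by blast
  interpret F: profile b q F by unfold_locales (rule assms q_def F)+
  obtain e where e: "e > 0" "F.shortest e" using F.shortest_ex by blast
  \<comment> \<open>The normalization at -e is possible only now that e is known; hence the earlier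
    interpretation with an arbitrary antiderivative \<open>F\<close>.\<close>
  define ell where "ell = (\<lambda>y. F y - F (- e))"
  have ell': "(ell has_real_derivative sqrt (1 + (q * pos_powr (q - 1) y)\<^sup>2)) (at y)" for y
    using DERIV_diff[OF F DERIV_const, of "F (- e)" y] by (simp add: ell_def)
  interpret profile b q ell by unfold_locales (rule assms q_def ell')+
  obtain r where r: "\<And>z. ell (r z) = z" "\<And>t. r (ell t) = t"
    "\<And>z. (r has_real_derivative 1 / speed (r z)) (at z)"
    using ell_inverse by blast
  have start: "ell (- e) = 0" by (simp add: ell_def)
  have "ell e - ell (- e) = F e - F (- e)" by (simp add: ell_def)
  then have shortest: "shortest e" using e(2) unfolding F.shortest_def shortest_def by presburger
  have one: "(1 :: real)\<^sup>2 = 1" "(- 1 :: real)\<^sup>2 = 1" by simp_all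
  interpret plus: unit_speed_arc b q ell e 1 r by unfold_locales (rule e(1) one start r shortest)+
  interpret minus: unit_speed_arc b q ell e "-1" r by unfold_locales (rule e(1) one start r shortest)+
  have L: "L_SR b (gamma b) (- e) t = ell t" "L_SR b (gamma_bar b) (- e) t = ell t" if "- e \<le> t" for t
    using L_SR_arc[OF _ that] by (simp_all add: gamma_eq gamma_bar_eq start)
  have Le: "L_SR b (gamma b) (- e) e = ell e" "L_SR b (gamma_bar b) (- e) e = ell e"
    and L0: "L_SR b (gamma b) (- e) 0 = ell 0"
    using L[of e] L[of 0] e(1) by auto
  have r_less: "r z < r w \<longleftrightarrow> z < w" for z w
    by (metis ell_less linorder_neqE_linordered_idom order_less_asym r(1))
  \<comment> \<open>\<open>ell 0\<close> is the branching time, and the arcs never meet again after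
    it.\<close>
  have eq: "plus.curve t = minus.curve t \<longleftrightarrow> t \<le> ell 0" for t
  proof -
    have "plus.curve t = minus.curve t \<longleftrightarrow> pos_powr q (r t) = 0"
      by (auto simp: plus.curve_def minus.curve_def gamma_sgn_def vec_eq_iff forall_3)
    also have "\<dots> \<longleftrightarrow> \<not> r (ell 0) < r t" by (auto simp: r(2) pos_powr_def)
    finally show ?thesis by (simp add: r_less not_less)
  qed
  show ?thesis
  proof (rule exI[of _ e], rule exI[of _ e], rule conjI[OF e(1)], rule conjI[OF e(1)],
      rule exI[of _ plus.curve], rule exI[of _ minus.curve], intro conjI ballI)
    show "plus.curve (L_SR b (gamma b) (- e) t) = gamma b t"
      "minus.curve (L_SR b (gamma_bar b) (- e) t) = gamma_bar b t" if "t \<in> {- e..e}" for t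
      using that L[of t] by (auto simp: plus.curve_def minus.curve_def r(2) gamma_eq gamma_bar_eq)
    show "plus.curve t = minus.curve t" if "t \<in> {0..L_SR b (gamma b) (- e) 0}" for t
      using that by (simp add: L0 eq)
    \<comment> \<open>The end time itself is the witness.\<close>
    show "\<exists>t\<in>{0..\<tau>}. plus.curve t \<noteq> minus.curve t"
      if "\<tau> \<in> {L_SR b (gamma b) (- e) 0<..L_SR b (gamma b) (- e) e}" for \<tau>
      using that ell_less[of "- e" 0] start e(1) by (intro bexI[of _ \<tau>]) (auto simp: L0 eq)
  qed (simp_all add: Le plus.curve_minimizing minus.curve_minimizing
        plus.curve_strictly_abnormal minus.curve_strictly_abnormal)
qed

end
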